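(* Let $\overline{x}\in\mathbb{X}$ be a stationary point of the nonlinear semidefinite program (NLSDP) $\min f(x)$ s.t. $h(x)=0$, $g(x)\in\mathbb{S}^n_+$, with a Lagrange multiplier $(\overline\xi,\overline\Gamma)\in M(\overline{x})$, and let $F$ be the associated KKT residual mapping. Suppose that the weak second order condition (W-SOC) and the weak strict Robinson constraint qualification (W-SRCQ) hold at $(\overline x,\overline\xi,\overline\Gamma)$. (i) There exists $t\in(0,1)$ such that $t\,\overline{\mathcal U}_0+(1-t)\,\overline{\mathcal U}_{\mathcal I}\in\partial_CF(\overline x,\overline\xi,\overline\Gamma)$ is nonsingular. (ii) If, additionally, the NLSDP is convex (i.e., $f$ is convex, $h$ is affine and $g$ is $\mathbb{S}^n_+$-convex), then for any $t\in(0,1)$, $t\,\overline{\mathcal U}_0+(1-t)\,\overline{\mathcal U}_{\mathcal I}\in\partial_CF(\overline x,\overline\xi,\overline\Gamma)$ is nonsingular.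
   Context: Setting. $\mathbb{X}$ is a finite-dimensional real Euclidean space; $\mathbb{S}^n$ is the space of real symmetric $n\times n$ matrices with the trace inner product, $\mathbb{S}^n_+$ the positive semidefinite cone. The functions $f:\mathbb{X}\to\mathbb{R}$, $h:\mathbb{X}\to\mathbb{R}^m$, $g:\mathbb{X}\to\mathbb{S}^n$ are twice continuously differentiable. "$g$ is $\mathbb{S}^n_+$-convex" means $g(tx+(1-t)y)-tg(x)-(1-t)g(y)\in\mathbb{S}^n_+$ for all $x,y\in\mathbb{X}$, $t\in(0,1)$. $L(x,\xi,\Gamma)=f(x)+\langle\xi,h(x)\rangle+\langle\Gamma,g(x)\rangle$. Put $\mathbb{Z}=\mathbb{X}\times\mathbb{R}^m\times\mathbb{S}^n$. A KKT point is $(x,\xi,\Gamma)\in\mathbb{Z}$ with $\nabla_xL(x,\xi,\Gamma)=0$, $h(x)=0$, $\Gamma\in\mathcal{N}_{\mathbb{S}^n_+}(g(x))$ (normal cone of convex analysis). $M(x)$ is the set of $(\xi,\Gamma)$ such that $(x,\xi,\Gamma)$ is a KKT point; a feasible $x$ is stationary if $M(x)\ne\emptyset$. With $\Pi_{\mathbb{S}^n_+}$ the metric projection onto $\mathbb{S}^n_+$, the KKT residual mapping $F:\mathbb{Z}\to\mathbb{Z}$ is $F(x,\xi,\Gamma)=\big(\nabla_xL(x,\xi,\Gamma),\,h(x),\,-g(x)+\Pi_{\mathbb{S}^n_+}(g(x)+\Gamma)\big)$. It is locally Lipschitz; $\partial_BF(Z)$ denotes the set of all limits of $F'(Z^k)$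 with $Z^k\to Z$, $F$ differentiable at $Z^k$, and $\partial_CF(Z)$ is the convex hull of $\partial_BF(Z)$. A linear operator is nonsingular if it is invertible. Eigenvalue notation. Let $A=g(\overline x)+\overline\Gamma=\overline P\,\mathrm{Diag}(\overline\lambda)\overline P^T$ with $\overline P$ orthogonal and $\overline\lambda$ the eigenvalues in nonincreasing order; $\alpha=\{i:\overline\lambda_i>0\}$, $\beta=\{i:\overline\lambda_i=0\}$, $\gamma=\{i:\overline\lambda_i<0\}$. Let $\overline{\mathcal B}(\Delta x)=\overline P^T(g'(\overline x)\Delta x)\overline P$, and let $\overline\Xi_{ij}=\overline\lambda_i/(\overline\lambda_i-\overline\lambda_j)$ for $i\in\alpha$, $j\in\gamma$, with $\overline\Xi_{\gamma\alpha}=\overline\Xi_{\alpha\gamma}^T$. $\circ$ is the Hadamard product. Conditions. - W-SRCQ: $(h'(\overline x),g'(\overline x))\mathbb{X}+\{0\}\times\{\overline PB\overline P^T:B\in\mathbb{S}^n,\ B_{\beta\gamma}=0,B_{\gamma\gamma}=0\}=\mathbb{R}^m\times\mathbb{S}^n$ (the second summand is $\{0\}\times$ the affine hull of $\mathcal T_{\mathbb{S}^n_+}(g(\overline x))\cap\overline\Gamma^\perp$, with $\mathcal T$ the tangent cone). - W-SOC: $\langle\Delta x,\nabla^2_{xx}L(\overline x,\overline\xi,\overline\Gamma)\Delta x\rangle-2\sum_{i\in\alpha}\sum_{j\in\gamma}\frac{\overline\lambda_j}{\overline\lambda_i}\overline{\mathcal B}(\Delta x)_{ij}^2>0$ for all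 nonzero $\Delta x\in\mathbb{X}$ with $h'(\overline x)\Delta x=0$, $\overline{\mathcal B}(\Delta x)_{\beta\beta}=0$, $\overline{\mathcal B}(\Delta x)_{\beta\gamma}=0$, $\overline{\mathcal B}(\Delta x)_{\gamma\gamma}=0$. The elements $\overline{\mathcal U}_0,\overline{\mathcal U}_{\mathcal I}$. For $H\in\mathbb{S}^n$ put $\widetilde H=\overline P^TH\overline P$ and $$\overline{\mathcal V}_0(H)=\overline P\begin{bmatrix}\widetilde H_{\alpha\alpha}&\widetilde H_{\alpha\beta}&\overline\Xi_{\alpha\gamma}\circ\widetilde H_{\alpha\gamma}\\ \widetilde H_{\beta\alpha}&0&0\\ \overline\Xi_{\gamma\alpha}\circ\widetilde H_{\gamma\alpha}&0&0\end{bmatrix}\overline P^T,$$ and let $\overline{\mathcal V}_{\mathcal I}(H)$ be the same expression with the $\beta\beta$ block $0$ replaced by $\widetilde H_{\beta\beta}$. For $l\in\{0,\mathcal I\}$, $$\overline{\mathcal U}_l(\Delta x,\Delta\xi,\Delta\Gamma)=\big(\nabla^2_{xx}L(\overline x,\overline\xi,\overline\Gamma)\Delta x+h'(\overline x)^*\Delta\xi+g'(\overline x)^*\Delta\Gamma,\ h'(\overline x)\Delta x,\ -g'(\overline x)\Delta x+\overline{\mathcal V}_l(g'(\overline x)\Delta x+\Delta\Gamma)\big).$$ Both are elements of $\partial_BF(\overline x,\overline\xi,\overline\Gamma)$. *)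

theory Defs
  imports "HOL-Analysis.Analysis"
begin

section \<open>The Euclidean space of real symmetric matrices\<close>

typedef ('n::finite) sym_mat = "{A :: real^'n^'n. transpose A = A}"
  morphisms mat_of sym_of
proof
  show "(0 :: real^'n^'n) \<in> {A. transpose A = A}"
    by (simp add: transpose_def vec_eq_iff)
qed

lemma transpose_mat_of [simp]: "transpose (mat_of A) = mat_of A"
  using mat_of [of A] by simp

lemma mat_of_sym: "mat_of A $ i $ j = mat_of A $ j $ i"
  using arg_cong [OF transpose_mat_of [of A], of "\<lambda>M. M $ i $ j"]
  by (simp add: transpose_def)

lemma mat_of_sym_of [simp]: "transpose A = A \<Longrightarrow> mat_of (sym_of A) = A"
  by (rule sym_of_inverse) simp

instantiation sym_mat :: (finite) real_vector
begin

definition "0 = sym_of 0"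
definition "A + B = sym_of (mat_of A + mat_of B)"
definition "- A = sym_of (- mat_of A)"
definition "A - B = sym_of (mat_of A - mat_of B)"
definition "r *\<^sub>R A = sym_of (r *\<^sub>R mat_of A)"

lemma mat_of_zero [simp]: "mat_of 0 = 0"
  unfolding zero_sym_mat_def by (rule mat_of_sym_of) (simp add: transpose_def vec_eq_iff)

lemma mat_of_plus [simp]: "mat_of (A + B) = mat_of A + mat_of B"
  unfolding plus_sym_mat_def
  by (rule mat_of_sym_of) (simp add: transpose_def vec_eq_iff mat_of_sym)

lemma mat_of_uminus [simp]: "mat_of (- A) = - mat_of A"
  unfolding uminus_sym_mat_def
  by (rule mat_of_sym_of) (simp add: transpose_def vec_eq_iff mat_of_sym)

lemma mat_of_minus [simp]: "mat_of (A - B) = mat_of A - mat_of B"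
  unfolding minus_sym_mat_def
  by (rule mat_of_sym_of) (simp add: transpose_def vec_eq_iff mat_of_sym)

lemma mat_of_scaleR [simp]: "mat_of (r *\<^sub>R A) = r *\<^sub>R mat_of A"
  unfolding scaleR_sym_mat_def
  by (rule mat_of_sym_of) (simp add: transpose_def vec_eq_iff mat_of_sym)

instance
  by standard (simp_all add: mat_of_inject [symmetric] algebra_simps)

end

instantiation sym_mat :: (finite) real_inner
begin

definition inner_sym_mat :: "'a sym_mat \<Rightarrow> 'a sym_mat \<Rightarrow> real"
  where "inner_sym_mat A B = trace (mat_of A ** mat_of B)"
definition norm_sym_mat :: "'a sym_mat \<Rightarrow> real"
  where "norm_sym_mat A = sqrt (A \<bullet> A)"
definition sgn_sym_mat :: "'a sym_mat \<Rightarrow> 'a sym_mat"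
  where "sgn_sym_mat A = A /\<^sub>R norm A"
definition dist_sym_mat :: "'a sym_mat \<Rightarrow> 'a sym_mat \<Rightarrow> real"
  where "dist_sym_mat A B = norm (A - B)"
definition uniformity_sym_mat :: "('a sym_mat \<times> 'a sym_mat) filter"
  where "uniformity_sym_mat = (INF e\<in>{0 <..}. principal {(x, y). dist x y < e})"
definition open_sym_mat :: "'a sym_mat set \<Rightarrow> bool"
  where "open_sym_mat U \<longleftrightarrow>
    (\<forall>x\<in>U. eventually (\<lambda>(x', y). x' = x \<longrightarrow> y \<in> U) uniformity)"

lemma inner_mat_of: "A \<bullet> B = mat_of A \<bullet> mat_of B"
  unfolding inner_sym_mat_def trace_def matrix_matrix_mult_def inner_vec_def
  by (simp add: mat_of_sym [of B])

instance
proof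
  fix A B C :: "'a sym_mat" and r :: real
  show "A \<bullet> B = B \<bullet> A" by (simp add: inner_mat_of inner_commute)
  show "(A + B) \<bullet> C = A \<bullet> C + B \<bullet> C" by (simp add: inner_mat_of inner_add_left)
  show "(r *\<^sub>R A) \<bullet> B = r * (A \<bullet> B)" by (simp add: inner_mat_of)
  show "0 \<le> A \<bullet> A" by (simp add: inner_mat_of)
  show "(A \<bullet> A = 0) = (A = 0)" by (simp add: inner_mat_of mat_of_inject [symmetric])
qed (simp_all add: norm_sym_mat_def sgn_sym_mat_def dist_sym_mat_def
    uniformity_sym_mat_def open_sym_mat_def)

end

lemma ex_sym_mat_basis:
  "\<exists>B :: 'n::finite sym_mat set. B \<noteq> {} \<and> finite B \<and>
     (\<forall>u\<in>B. \<forall>v\<in>B. u \<bullet> v = (if u = v then 1 else 0)) \<and>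
     (\<forall>x. (\<forall>u\<in>B. x \<bullet> u = 0) \<longleftrightarrow> x = 0)"
proof -
  let ?S = "range (mat_of :: 'n sym_mat \<Rightarrow> _)"
  have "linear (mat_of :: 'n sym_mat \<Rightarrow> _)"
    by (rule linearI) simp_all
  then have "subspace ?S"
    by (rule linear_subspace_image) simp
  from orthonormal_basis_subspace [OF this]
  obtain B where B: "B \<subseteq> ?S" "pairwise orthogonal B" "\<And>x. x \<in> B \<Longrightarrow> norm x = 1"
    "independent B" "span B = ?S" by metis
  let ?B = "mat_of -` B :: 'n sym_mat set"
  have fin: "finite ?B"
    using B(4) independent_imp_finite mat_of_inject
    by (intro finite_vimageI) (auto simp: inj_on_def)
  have orth: "u \<bullet> v = (if u = v then 1 else 0)" if "u \<in> ?B" "v \<in> ?B" for u v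
  proof (cases "u = v")
    case True
    then show ?thesis using B(3) that by (simp add: inner_mat_of dot_square_norm)
  next
    case False
    then have "mat_of u \<noteq> mat_of v" by (simp add: mat_of_inject)
    then show ?thesis
      using False B(2) that by (auto simp: inner_mat_of pairwise_def orthogonal_def)
  qed
  have zero: "x = 0" if x: "\<forall>u\<in>?B. x \<bullet> u = 0" for x
  proof -
    have "mat_of x \<bullet> b = 0" if "b \<in> B" for b
      using B(1) x that by (auto simp: inner_mat_of)
    moreover have "mat_of x \<in> span B" using B(5) by blast
    ultimately have "orthogonal (mat_of x) (mat_of x)"
      using orthogonal_to_span [of "mat_of x" B "mat_of x"] by (simp add: orthogonal_def)
    then show ?thesis by (simp add: orthogonal_def mat_of_inject [symmetric])
  qed
  have "mat_of (sym_of (mat 1) :: 'n sym_mat) = mat 1" by simp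
  moreover have "(mat 1 :: real^'n^'n) \<noteq> 0" by (simp add: vec_eq_iff mat_def)
  ultimately have "(sym_of (mat 1) :: 'n sym_mat) \<noteq> 0"
    using mat_of_zero by metis
  then have "?B \<noteq> {}" using zero by blast
  with fin orth zero show ?thesis by (intro exI [of _ ?B]) auto
qed

instantiation sym_mat :: (finite) euclidean_space
begin

text \<open>Some orthonormal basis; which one is immaterial.\<close>

definition Basis_sym_mat :: "'a sym_mat set"
  where "Basis_sym_mat = (SOME B. B \<noteq> {} \<and> finite B \<and>
     (\<forall>u\<in>B. \<forall>v\<in>B. u \<bullet> v = (if u = v then 1 else 0)) \<and>
     (\<forall>x. (\<forall>u\<in>B. x \<bullet> u = 0) \<longleftrightarrow> x = 0))"

instance
proof
  have *: "(Basis :: 'a sym_mat set) \<noteq> {} \<and> finite (Basis :: 'a sym_mat set) \<and>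
     (\<forall>u\<in>(Basis :: 'a sym_mat set). \<forall>v\<in>Basis. u \<bullet> v = (if u = v then 1 else 0)) \<and>
     (\<forall>x :: 'a sym_mat. (\<forall>u\<in>Basis. x \<bullet> u = 0) \<longleftrightarrow> x = 0)"
    unfolding Basis_sym_mat_def by (rule someI_ex [OF ex_sym_mat_basis])
  show "(Basis :: 'a sym_mat set) \<noteq> {}"
    by (fact *[THEN conjunct1])
  show "finite (Basis :: 'a sym_mat set)"
    by (fact *[THEN conjunct2, THEN conjunct1])
  show "u \<bullet> v = (if u = v then 1 else 0)" if "u \<in> Basis" "v \<in> Basis" for u v :: "'a sym_mat"
    by (fact *[THEN conjunct2, THEN conjunct2, THEN conjunct1, THEN bspec, THEN bspec, OF that])
  show "(\<forall>u\<in>Basis. x \<bullet> u = 0) \<longleftrightarrow> x = 0" for x :: "'a sym_mat"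
    by (fact *[THEN conjunct2, THEN conjunct2, THEN conjunct2, THEN spec])
qed

end

definition psd_cone :: "'n::finite sym_mat set"
  where "psd_cone = {A. \<forall>v. 0 \<le> v \<bullet> (mat_of A *v v)}"

definition conj_by :: "real^'n^'n \<Rightarrow> 'n sym_mat \<Rightarrow> 'n::finite sym_mat"
  where "conj_by P A = sym_of (P ** mat_of A ** transpose P)"

lemma mat_of_conj_by: "mat_of (conj_by P A) = P ** mat_of A ** transpose P"
  unfolding conj_by_def
  by (rule mat_of_sym_of) (simp add: matrix_transpose_mul matrix_mul_assoc)

definition diag_sym :: "('n \<Rightarrow> real) \<Rightarrow> 'n::finite sym_mat"
  where "diag_sym d = sym_of (\<chi> i j. if i = j then d i else 0)"

lemma mat_of_diag_sym: "mat_of (diag_sym d) = (\<chi> i j. if i = j then d i else 0)"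
  unfolding diag_sym_def by (rule mat_of_sym_of) (auto simp: transpose_def vec_eq_iff)


section \<open>Smoothness and generalized derivatives\<close>

definition twice_continuously_differentiable ::
    "('a::real_normed_vector \<Rightarrow> 'b::real_normed_vector) \<Rightarrow> bool"
  where "twice_continuously_differentiable \<phi> \<longleftrightarrow>
    (\<exists>(D :: 'a \<Rightarrow> 'a \<Rightarrow>\<^sub>L 'b) (D2 :: 'a \<Rightarrow> 'a \<Rightarrow>\<^sub>L 'a \<Rightarrow>\<^sub>L 'b).
       (\<forall>x. (\<phi> has_derivative blinfun_apply (D x)) (at x)) \<and>
       (\<forall>x. (D has_derivative blinfun_apply (D2 x)) (at x)) \<and>
       continuous_on UNIV D2)"

definition gradient :: "('a::real_inner \<Rightarrow> real) \<Rightarrow> 'a \<Rightarrow> 'a"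
  where "gradient \<phi> x = (THE d. GDERIV \<phi> x :> d)"

definition hessian :: "('a::real_inner \<Rightarrow> real) \<Rightarrow> 'a \<Rightarrow> 'a \<Rightarrow> 'a"
  where "hessian \<phi> x = frechet_derivative (gradient \<phi>) (at x)"

definition bouligand_subdifferential ::
    "('a::real_normed_vector \<Rightarrow> 'b::real_normed_vector) \<Rightarrow> 'a \<Rightarrow> ('a \<Rightarrow>\<^sub>L 'b) set"
  where "bouligand_subdifferential \<Phi> z =
    {V. \<exists>zs Vs. zs \<longlonglongrightarrow> z \<and>
          (\<forall>k. (\<Phi> has_derivative blinfun_apply (Vs k)) (at (zs k))) \<and> Vs \<longlonglongrightarrow> V}"

definition clarke_subdifferential ::
    "('a::real_normed_vector \<Rightarrow> 'b::real_normed_vector) \<Rightarrow> 'a \<Rightarrow> ('a \<Rightarrow>\<^sub>L 'b) set"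
  where "clarke_subdifferential \<Phi> z = convex hull (bouligand_subdifferential \<Phi> z)"

definition nonsingular :: "('a::real_vector \<Rightarrow> 'a) \<Rightarrow> bool"
  where "nonsingular T \<longleftrightarrow> linear T \<and> bij T"

definition normal_cone :: "'a::real_inner set \<Rightarrow> 'a \<Rightarrow> 'a set"
  where "normal_cone C y = {v. y \<in> C \<and> (\<forall>z\<in>C. v \<bullet> (z - y) \<le> 0)}"


section \<open>The nonlinear semidefinite program\<close>

definition lagrangian ::
    "('a \<Rightarrow> real) \<Rightarrow> ('a \<Rightarrow> real^'m) \<Rightarrow> ('a \<Rightarrow> 'n sym_mat) \<Rightarrow>
     'a \<Rightarrow> real^'m \<Rightarrow> 'n::finite sym_mat \<Rightarrow> real"
  where "lagrangian f h g x \<xi> \<Gamma> = f x + \<xi> \<bullet> h x + \<Gamma> \<bullet> g x"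

abbreviation grad_lagrangian ::
    "('a::euclidean_space \<Rightarrow> real) \<Rightarrow> ('a \<Rightarrow> real^'m) \<Rightarrow> ('a \<Rightarrow> 'n sym_mat) \<Rightarrow>
     'a \<Rightarrow> real^'m \<Rightarrow> 'n::finite sym_mat \<Rightarrow> 'a"
  where "grad_lagrangian f h g x \<xi> \<Gamma> \<equiv> gradient (\<lambda>y. lagrangian f h g y \<xi> \<Gamma>) x"

abbreviation hess_lagrangian ::
    "('a::euclidean_space \<Rightarrow> real) \<Rightarrow> ('a \<Rightarrow> real^'m) \<Rightarrow> ('a \<Rightarrow> 'n sym_mat) \<Rightarrow>
     'a \<Rightarrow> real^'m \<Rightarrow> 'n::finite sym_mat \<Rightarrow> 'a \<Rightarrow> 'a"
  where "hess_lagrangian f h g x \<xi> \<Gamma> \<equiv> hessian (\<lambda>y. lagrangian f h g y \<xi> \<Gamma>) x"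

definition kkt_point ::
    "('a::euclidean_space \<Rightarrow> real) \<Rightarrow> ('a \<Rightarrow> real^'m) \<Rightarrow> ('a \<Rightarrow> 'n sym_mat) \<Rightarrow>
     'a \<times> (real^'m) \<times> 'n::finite sym_mat \<Rightarrow> bool"
  where "kkt_point f h g = (\<lambda>(x, \<xi>, \<Gamma>).
    grad_lagrangian f h g x \<xi> \<Gamma> = 0 \<and> h x = 0 \<and> \<Gamma> \<in> normal_cone psd_cone (g x))"

definition multipliers ::
    "('a::euclidean_space \<Rightarrow> real) \<Rightarrow> ('a \<Rightarrow> real^'m) \<Rightarrow> ('a \<Rightarrow> 'n sym_mat) \<Rightarrow>
     'a \<Rightarrow> ((real^'m) \<times> 'n::finite sym_mat) set"
  where "multipliers f h g x = {(\<xi>, \<Gamma>). kkt_point f h g (x, \<xi>, \<Gamma>)}"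

definition stationary_point ::
    "('a::euclidean_space \<Rightarrow> real) \<Rightarrow> ('a \<Rightarrow> real^'m) \<Rightarrow> ('a \<Rightarrow> 'n::finite sym_mat) \<Rightarrow>
     'a \<Rightarrow> bool"
  where "stationary_point f h g x \<longleftrightarrow>
    h x = 0 \<and> g x \<in> psd_cone \<and> multipliers f h g x \<noteq> {}"

definition kkt_residual ::
    "('a::euclidean_space \<Rightarrow> real) \<Rightarrow> ('a \<Rightarrow> real^'m) \<Rightarrow> ('a \<Rightarrow> 'n sym_mat) \<Rightarrow>
     'a \<times> (real^'m) \<times> 'n::finite sym_mat \<Rightarrow> 'a \<times> (real^'m) \<times> 'n sym_mat"
  where "kkt_residual f h g = (\<lambda>(x, \<xi>, \<Gamma>).
    (grad_lagrangian f h g x \<xi> \<Gamma>, h x, - g x + closest_point psd_cone (g x + \<Gamma>)))"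

definition psd_convex :: "('a::real_vector \<Rightarrow> 'n::finite sym_mat) \<Rightarrow> bool"
  where "psd_convex g \<longleftrightarrow> (\<forall>x y. \<forall>t\<in>{0<..<1}.
    g (t *\<^sub>R x + (1 - t) *\<^sub>R y) - t *\<^sub>R g x - (1 - t) *\<^sub>R g y \<in> psd_cone)"

definition convex_nlsdp ::
    "('a::euclidean_space \<Rightarrow> real) \<Rightarrow> ('a \<Rightarrow> real^'m) \<Rightarrow> ('a \<Rightarrow> 'n::finite sym_mat) \<Rightarrow> bool"
  where "convex_nlsdp f h g \<longleftrightarrow>
    convex_on UNIV f \<and> (\<exists>T c. linear T \<and> (\<forall>x. h x = T x + c)) \<and> psd_convex g"


section \<open>Spectral data, constraint qualification and second order condition\<close>

definition ix_pos :: "('n \<Rightarrow> real) \<Rightarrow> 'n set"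
  where "ix_pos lam = {i. lam i > 0}"
definition ix_zero :: "('n \<Rightarrow> real) \<Rightarrow> 'n set"
  where "ix_zero lam = {i. lam i = 0}"
definition ix_neg :: "('n \<Rightarrow> real) \<Rightarrow> 'n set"
  where "ix_neg lam = {i. lam i < 0}"

definition spectral_decomposition ::
    "'n sym_mat \<Rightarrow> real^'n::{finite,linorder}^'n::{finite,linorder} \<Rightarrow> ('n \<Rightarrow> real) \<Rightarrow> bool"
  where "spectral_decomposition A P lam \<longleftrightarrow>
    orthogonal_matrix P \<and> antimono lam \<and> A = conj_by P (diag_sym lam)"

definition calB ::
    "('a::euclidean_space \<Rightarrow> 'n sym_mat) \<Rightarrow> 'a \<Rightarrow> real^'n^'n \<Rightarrow> 'a \<Rightarrow> 'n::finite sym_mat"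
  where "calB g x P d = conj_by (transpose P) (frechet_derivative g (at x) d)"

definition W_SRCQ ::
    "('a::euclidean_space \<Rightarrow> real^'m) \<Rightarrow> ('a \<Rightarrow> 'n::finite sym_mat) \<Rightarrow> 'a \<Rightarrow>
     real^'n^'n \<Rightarrow> ('n \<Rightarrow> real) \<Rightarrow> bool"
  where "W_SRCQ h g x P lam \<longleftrightarrow>
    {u + v | u v.
       u \<in> range (\<lambda>d. (frechet_derivative h (at x) d, frechet_derivative g (at x) d)) \<and>
       v \<in> {0} \<times> {conj_by P B | B.
              (\<forall>i\<in>ix_zero lam. \<forall>j\<in>ix_neg lam. mat_of B $ i $ j = 0) \<and>
              (\<forall>i\<in>ix_neg lam. \<forall>j\<in>ix_neg lam. mat_of B $ i $ j = 0)}} = UNIV"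

definition W_SOC ::
    "('a::euclidean_space \<Rightarrow> real) \<Rightarrow> ('a \<Rightarrow> real^'m) \<Rightarrow> ('a \<Rightarrow> 'n::finite sym_mat) \<Rightarrow>
     'a \<Rightarrow> real^'m \<Rightarrow> 'n sym_mat \<Rightarrow> real^'n^'n \<Rightarrow> ('n \<Rightarrow> real) \<Rightarrow> bool"
  where "W_SOC f h g x \<xi> \<Gamma> P lam \<longleftrightarrow>
    (\<forall>d. d \<noteq> 0 \<and> frechet_derivative h (at x) d = 0 \<and>
       (\<forall>i\<in>ix_zero lam. \<forall>j\<in>ix_zero lam. mat_of (calB g x P d) $ i $ j = 0) \<and>
       (\<forall>i\<in>ix_zero lam. \<forall>j\<in>ix_neg lam. mat_of (calB g x P d) $ i $ j = 0) \<and>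
       (\<forall>i\<in>ix_neg lam. \<forall>j\<in>ix_neg lam. mat_of (calB g x P d) $ i $ j = 0) \<longrightarrow>
       d \<bullet> hess_lagrangian f h g x \<xi> \<Gamma> d
         - 2 * (\<Sum>i\<in>ix_pos lam. \<Sum>j\<in>ix_neg lam.
                  lam j / lam i * (mat_of (calB g x P d) $ i $ j)\<^sup>2) > 0)"


section \<open>The distinguished elements of the generalized Jacobian\<close>

text \<open>
  Only pairs with one positive and one negative eigenvalue are ever used. The second branch makes
  the array symmetric on those pairs.
\<close>

definition Xi :: "('n \<Rightarrow> real) \<Rightarrow> 'n \<Rightarrow> 'n \<Rightarrow> real"
  where "Xi lam i j =
    (if i \<in> ix_pos lam then lam i / (lam i - lam j) else lam j / (lam j - lam i))"

text \<open>
  The scalar \<open>s\<close> multiplies the block whose row and column indices both belong to zero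
  eigenvalues; that block is \<open>0\<close> for \<open>V_zero\<close> and is kept unchanged for \<open>V_id\<close>.
\<close>

definition block_mat :: "('n \<Rightarrow> real) \<Rightarrow> real \<Rightarrow> 'n::finite sym_mat \<Rightarrow> real^'n^'n"
  where "block_mat lam s H = (\<chi> i j.
    if i \<in> ix_pos lam \<and> j \<in> ix_pos lam \<union> ix_zero lam \<or> i \<in> ix_zero lam \<and> j \<in> ix_pos lam
      then mat_of H $ i $ j
    else if i \<in> ix_pos lam \<and> j \<in> ix_neg lam \<or> i \<in> ix_neg lam \<and> j \<in> ix_pos lam
      then Xi lam i j * mat_of H $ i $ j
    else if i \<in> ix_zero lam \<and> j \<in> ix_zero lam then s * mat_of H $ i $ j
    else 0)"

lemma mat_of_block_mat: "mat_of (sym_of (block_mat lam s H)) = block_mat lam s H"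
proof (rule mat_of_sym_of)
  have "block_mat lam s H $ j $ i = block_mat lam s H $ i $ j" for i j
    using mat_of_sym [of H i j]
    by (cases "lam i" "0 :: real" rule: linorder_cases;
        cases "lam j" "0 :: real" rule: linorder_cases)
      (simp_all add: block_mat_def Xi_def ix_pos_def ix_zero_def ix_neg_def)
  then show "transpose (block_mat lam s H) = block_mat lam s H"
    by (simp add: transpose_def vec_eq_iff)
qed

definition V_zero :: "real^'n^'n \<Rightarrow> ('n \<Rightarrow> real) \<Rightarrow> 'n sym_mat \<Rightarrow> 'n::finite sym_mat"
  where "V_zero P lam H = conj_by P (sym_of (block_mat lam 0 (conj_by (transpose P) H)))"

definition V_id :: "real^'n^'n \<Rightarrow> ('n \<Rightarrow> real) \<Rightarrow> 'n sym_mat \<Rightarrow> 'n::finite sym_mat"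
  where "V_id P lam H = conj_by P (sym_of (block_mat lam 1 (conj_by (transpose P) H)))"

definition U_of ::
    "('n sym_mat \<Rightarrow> 'n sym_mat) \<Rightarrow>
     ('a::euclidean_space \<Rightarrow> real) \<Rightarrow> ('a \<Rightarrow> real^'m) \<Rightarrow> ('a \<Rightarrow> 'n sym_mat) \<Rightarrow>
     'a \<Rightarrow> real^'m \<Rightarrow> 'n sym_mat \<Rightarrow>
     'a \<times> (real^'m) \<times> 'n::finite sym_mat \<Rightarrow> 'a \<times> (real^'m) \<times> 'n sym_mat"
  where "U_of V f h g x \<xi> \<Gamma> = (\<lambda>(dx, d\<xi>, d\<Gamma>).
    (hess_lagrangian f h g x \<xi> \<Gamma> dx
       + adjoint (frechet_derivative h (at x)) d\<xi> + adjoint (frechet_derivative g (at x)) d\<Gamma>,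
     frechet_derivative h (at x) dx,
     - frechet_derivative g (at x) dx + V (frechet_derivative g (at x) dx + d\<Gamma>)))"

end

theory Submission
  imports Defs
begin

text \<open>
  The projection onto the cone is differentiable at every nonsingular \<open>A\<close>; in an eigenbasis of \<open>A\<close>
  its derivative multiplies entry \<open>(i, j)\<close> by
  \<open>(1 + (\<lambda>\<^sub>i + \<lambda>\<^sub>j) / (\<bar>\<lambda>\<^sub>i\<bar> + \<bar>\<lambda>\<^sub>j\<bar>)) / 2\<close>. Moving the zero eigenvalues of \<open>g(x) + \<Gamma>\<close> to
  \<open>-\<epsilon>\<close> or to \<open>+\<epsilon>\<close> by a perturbation of \<open>\<Gamma>\<close> alone and letting \<open>\<epsilon>\<close> tend to zero exhibits \<open>U\<^sub>0\<close> and
  \<open>U\<^sub>I\<close> as limits of Jacobians.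

  If \<open>(d, \<eta>, \<Delta>)\<close> is in the kernel of \<open>t U\<^sub>0 + (1 - t) U\<^sub>I\<close>, pairing the first component with \<open>d\<close> and
  solving the third one blockwise for \<open>\<Delta>\<close> gives \<open>q(d) + t / (1 - t) \<parallel>B\<^sub>\<beta>\<^sub>\<beta>\<parallel>\<^sup>2 = 0\<close>, where \<open>q\<close> is the
  quadratic form of W-SOC. This forces \<open>d = 0\<close> for \<open>t\<close> close to 1 by a penalty argument, and for
  every \<open>t\<close> in the convex case because then \<open>q \<ge> 0\<close>. Given \<open>d = 0\<close>, the pair \<open>(\<eta>, \<Delta>)\<close> is orthogonal
  to the sum of subspaces in W-SRCQ, hence zero.
\<close>

section \<open>The projection onto the positive semidefinite cone\<close>

lemma matrix_mult_distrib:
  fixes A :: "real^'n^'m"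
  shows "(A + B) ** C = A ** C + B ** C" "(A - B) ** C = A ** C - B ** C"
    "D ** (A + B) = D ** A + D ** B" "D ** (A - B) = D ** A - D ** B"
    "(r *\<^sub>R A) ** C = r *\<^sub>R (A ** C)" "D ** (r *\<^sub>R A) = r *\<^sub>R (D ** A)"
  by (simp_all add: matrix_matrix_mult_def vec_eq_iff sum.distrib sum_subtractf algebra_simps
      sum_distrib_left)

lemma transpose_add_diff:
  fixes A :: "real^'n^'m"
  shows "transpose (A + B) = transpose A + transpose B"
    "transpose (A - B) = transpose A - transpose B"
  by (simp_all add: transpose_def vec_eq_iff)

lemma matrix_inner_trace: "(A :: real^'n^'m) \<bullet> B = trace (transpose A ** B)"
  unfolding trace_def matrix_matrix_mult_def transpose_def inner_vec_def
  by (simp add: sum.swap [of _ "UNIV :: 'n set"])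

lemma matrix_inner_mult_left:
  fixes A :: "real^'n^'m" shows "(A ** B) \<bullet> C = B \<bullet> (transpose A ** C)"
  by (simp add: matrix_inner_trace matrix_transpose_mul matrix_mul_assoc)

lemma matrix_inner_mult_right:
  fixes A :: "real^'n^'m" shows "(A ** B) \<bullet> C = A \<bullet> (C ** transpose B)"
  by (simp add: matrix_inner_trace matrix_transpose_mul matrix_mul_assoc
      trace_mul_sym [of "transpose A ** C" "transpose B"])

lemma inner_transpose_transpose: "transpose A \<bullet> transpose B = (A :: real^'n^'m) \<bullet> B"
  by (simp add: transpose_def inner_vec_def sum.swap [of _ "UNIV :: 'm set"])

lemma sym_mat_eq_iff: "A = B \<longleftrightarrow> (\<forall>i j. mat_of A $ i $ j = mat_of B $ i $ j)"
  by (simp add: mat_of_inject [symmetric] vec_eq_iff)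

section \<open>Congruences and orthogonal changes of basis\<close>

lemma linear_conj_by: "linear (conj_by P)"
  by (rule linearI; simp add: mat_of_inject [symmetric] mat_of_conj_by matrix_mult_distrib)

lemma inner_conj_by: "conj_by P A \<bullet> B = A \<bullet> conj_by (transpose P) B"
  by (simp add: inner_mat_of mat_of_conj_by matrix_inner_mult_right [of "P ** mat_of A"]
      matrix_inner_mult_left [of P] matrix_mul_assoc)

lemma conj_by_conj_by: "conj_by P (conj_by Q A) = conj_by (P ** Q) A"
  by (simp add: mat_of_inject [symmetric] mat_of_conj_by matrix_transpose_mul matrix_mul_assoc)

lemma conj_by_one [simp]: "conj_by (mat 1) A = A"
  by (simp add: mat_of_inject [symmetric] mat_of_conj_by)

lemma conj_by_orthogonal_cancel:
  assumes "orthogonal_matrix P"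
  shows "conj_by P (conj_by (transpose P) A) = A" "conj_by (transpose P) (conj_by P A) = A"
  using assms by (simp_all add: conj_by_conj_by orthogonal_matrix_def)

lemma inner_conj_by_orthogonal:
  assumes "orthogonal_matrix P"
  shows "conj_by (transpose P) A \<bullet> conj_by (transpose P) B = A \<bullet> B"
  using assms by (simp add: inner_conj_by conj_by_orthogonal_cancel)

lemma norm_conj_by_orthogonal:
  "orthogonal_matrix P \<Longrightarrow> norm (conj_by (transpose P) A) = norm A"
  by (simp add: norm_eq_sqrt_inner inner_conj_by_orthogonal)

lemma norm_mat_of: "norm (mat_of A) = norm A"
  by (simp add: norm_eq_sqrt_inner inner_mat_of)

section \<open>The semidefinite cone as a closed convex cone\<close>

lemma psd_cone_conj_by:
  assumes "A \<in> psd_cone" shows "conj_by P A \<in> psd_cone"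
proof -
  have "v \<bullet> (mat_of (conj_by P A) *v v) = (transpose P *v v) \<bullet> (mat_of A *v (transpose P *v v))" for v
    by (simp add: mat_of_conj_by matrix_vector_mul_assoc [symmetric] dot_lmul_matrix [symmetric])
  then show ?thesis using assms by (simp add: psd_cone_def del: transpose_matrix_vector)
qed

lemma psd_cone_add: "A \<in> psd_cone \<Longrightarrow> B \<in> psd_cone \<Longrightarrow> A + B \<in> psd_cone"
  by (simp add: psd_cone_def matrix_vector_mult_add_rdistrib inner_add_right)

lemma psd_cone_scaleR: "A \<in> psd_cone \<Longrightarrow> 0 \<le> c \<Longrightarrow> c *\<^sub>R A \<in> psd_cone"
  by (simp add: psd_cone_def scaleR_matrix_vector_assoc [symmetric])

lemma zero_in_psd_cone: "0 \<in> psd_cone"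
  by (simp add: psd_cone_def)

lemma convex_psd_cone: "convex psd_cone"
  by (auto simp: convex_def intro!: psd_cone_add psd_cone_scaleR)

lemma closed_psd_cone: "closed (psd_cone :: 'n::finite sym_mat set)"
proof -
  have eq: "psd_cone = (\<Inter>v. {A :: 'n sym_mat. 0 \<le> v \<bullet> (mat_of A *v v)})"
    by (auto simp: psd_cone_def)
  have "linear (\<lambda>A :: 'n sym_mat. v \<bullet> (mat_of A *v v))" for v
    by (rule linearI)
      (simp_all add: matrix_vector_mult_add_rdistrib inner_add_right
        scaleR_matrix_vector_assoc [symmetric])
  then have "continuous_on UNIV (\<lambda>A :: 'n sym_mat. v \<bullet> (mat_of A *v v))" for v
    by (simp add: linear_continuous_on linear_conv_bounded_linear)
  then show ?thesis
    unfolding eq by (intro closed_INT ballI closed_Collect_le) auto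
qed

text \<open>Expanding the squared distance from \<open>Y\<close> to \<open>Z\<close> around
  \<open>X\<close> leaves a cross term that the variational inequality makes harmless, so no point
  of the cone is nearer than \<open>X\<close>.\<close>

lemma psd_cone_closest_point_unique:
  assumes "X \<in> psd_cone" "\<And>Z. Z \<in> psd_cone \<Longrightarrow> (Y - X) \<bullet> (Z - X) \<le> 0"
  shows "closest_point psd_cone Y = X"
proof (rule closest_point_unique [OF convex_psd_cone closed_psd_cone assms(1), symmetric], rule ballI)
  fix Z :: "'a sym_mat" assume "Z \<in> psd_cone"
  have "(Y - Z) \<bullet> (Y - Z)
      = (Y - X) \<bullet> (Y - X) - 2 * ((Y - X) \<bullet> (Z - X)) + (Z - X) \<bullet> (Z - X)"
    by (simp add: inner_diff_left inner_diff_right inner_commute)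
  also have "\<dots> \<ge> (Y - X) \<bullet> (Y - X)"
    using assms(2) [OF \<open>Z \<in> psd_cone\<close>] inner_ge_zero [of "Z - X"] by linarith
  finally show "dist Y X \<le> dist Y Z"
    by (simp add: dist_norm norm_le)
qed

lemma quadratic_nonneg_imp_linear_zero:
  fixes a b :: real
  assumes "\<And>t. 0 \<le> t * a + t\<^sup>2 * b" shows "a = 0"
proof (rule ccontr)
  assume a: "a \<noteq> 0"
  \<comment> \<open>This is the nonzero root of
    \<open>t * a + t\<^sup>2 * (1 + \<bar>b\<bar>)\<close>, an expression strictly above the assumed
    nonnegative one.\<close>
  define t where "t = - a / (1 + \<bar>b\<bar>)"
  have "t \<noteq> 0" using a by (simp add: t_def)
  have "t * a + t\<^sup>2 * b \<le> t * a + t\<^sup>2 * \<bar>b\<bar>"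
    by (simp add: mult_left_mono)
  also have "\<dots> < t * a + t\<^sup>2 * (1 + \<bar>b\<bar>)"
    using \<open>t \<noteq> 0\<close> by (simp add: distrib_left)
  also have "\<dots> = 0"
    by (simp add: t_def power2_eq_square field_simps add_nonneg_eq_0_iff)
  finally show False using assms [of t] by simp
qed

text \<open>
  Congruence with \<open>I + t N X\<close> keeps \<open>X\<close> in the cone for every real \<open>t\<close>, so the first order term
  \<open>2 t \<parallel>X N\<parallel>\<^sup>2\<close> of the variational inequality has to vanish.
\<close>

lemma psd_projection_complementary:
  assumes X: "X = closest_point psd_cone Y" and N: "N = X - Y"
  shows "mat_of X ** mat_of N = 0"
proof -
  let ?x = "mat_of X" and ?n = "mat_of N"
  have Xin: "X \<in> psd_cone"
    unfolding X using closed_psd_cone zero_in_psd_cone by (intro closest_point_in_set) auto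
  have "0 \<le> t * (2 * (norm (?x ** ?n))\<^sup>2) + t\<^sup>2 * (?n \<bullet> (?n ** ?x ** ?x ** ?x ** ?n))" for t
  proof -
    let ?Q = "mat 1 + t *\<^sub>R (?n ** ?x)"
    define Z where "Z = conj_by ?Q X"
    have "Z \<in> psd_cone" unfolding Z_def by (rule psd_cone_conj_by [OF Xin])
    then have "(Y - X) \<bullet> (Z - X) \<le> 0"
      unfolding X by (rule closest_point_dot [OF convex_psd_cone closed_psd_cone])
    then have "0 \<le> N \<bullet> (Z - X)"
      unfolding N by (simp add: inner_diff_left)
    moreover have "transpose ?Q = mat 1 + t *\<^sub>R (?x ** ?n)"
      by (simp add: transpose_add_diff transpose_scalar matrix_transpose_mul)
    then have "mat_of (Z - X) = t *\<^sub>R (?n ** ?x ** ?x + ?x ** ?x ** ?n)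
        + t\<^sup>2 *\<^sub>R (?n ** ?x ** ?x ** ?x ** ?n)"
      by (simp add: Z_def mat_of_conj_by matrix_mult_distrib matrix_mul_assoc algebra_simps
          power2_eq_square)
    \<comment> \<open>Both first-order terms are the same squared norm, because
      \<open>?n ** ?x\<close> is the transpose of \<open>?x ** ?n\<close>.\<close>
    moreover have "?n \<bullet> (?n ** ?x ** ?x) = (norm (?x ** ?n))\<^sup>2"
    proof -
      have "?n \<bullet> (?n ** ?x ** ?x) = (?n ** ?x) \<bullet> (?n ** ?x)"
        by (simp add: inner_commute [of ?n] matrix_inner_mult_right [of "?n ** ?x" ?x])
      also have "\<dots> = transpose (?x ** ?n) \<bullet> transpose (?x ** ?n)"
        by (simp add: matrix_transpose_mul)
      finally show ?thesis
        by (simp only: inner_transpose_transpose power2_norm_eq_inner)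
    qed
    moreover have "?n \<bullet> (?x ** ?x ** ?n) = (norm (?x ** ?n))\<^sup>2"
      by (simp add: power2_norm_eq_inner matrix_inner_mult_left [of ?x ?n] matrix_mul_assoc)
    ultimately show ?thesis
      by (simp add: inner_mat_of inner_add_right)
  qed
  then have "2 * (norm (?x ** ?n))\<^sup>2 = 0"
    by (rule quadratic_nonneg_imp_linear_zero)
  then show ?thesis by simp
qed

text \<open>With X the projection of \<open>Y\<close> and N = X - Y, one has M = X + N and Y = X -
  N. Complementarity gives XN = NX = 0, so both squares equal X^2 + N^2. No eigenbasis of
  \<open>Y\<close> enters, which matters once \<open>Y\<close> varies around a fixed matrix.\<close>

lemma psd_projection_square:
  fixes Y :: "'n::finite sym_mat"
  defines "M \<equiv> 2 *\<^sub>R closest_point psd_cone Y - Y"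
  shows "mat_of M ** mat_of M = mat_of Y ** mat_of Y"
proof -
  define X where "X = closest_point psd_cone Y"
  define N where "N = X - Y"
  have xn: "mat_of X ** mat_of N = 0"
    by (rule psd_projection_complementary [OF X_def N_def])
  have "mat_of N ** mat_of X = transpose (mat_of X ** mat_of N)"
    by (simp add: matrix_transpose_mul)
  then have nx: "mat_of N ** mat_of X = 0"
    by (simp add: xn transpose_def vec_eq_iff)
  have "M = X + N" "Y = X - N"
    by (simp_all add: M_def X_def N_def algebra_simps scaleR_2)
  then show ?thesis by (simp add: matrix_mult_distrib xn nx)
qed

text \<open>In the basis \<open>P\<close> the residual is diagonal with entries min(l i, 0). It is
  complementary to the entries max(l i, 0), and it pairs nonpositively with the diagonal of any
  matrix in the cone, so the variational inequality holds.\<close>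

lemma psd_projection_diagonal:
  assumes "orthogonal_matrix P"
  shows "closest_point psd_cone (conj_by P (diag_sym l)) = conj_by P (diag_sym (\<lambda>i. max (l i) 0))"
    (is "_ = conj_by P ?D")
proof (rule psd_cone_closest_point_unique)
  have diag_psd: "diag_sym d \<in> psd_cone" if "\<And>i. 0 \<le> d i" for d :: "'a \<Rightarrow> real"
  proof -
    have "v \<bullet> (mat_of (diag_sym d) *v v) = (\<Sum>i\<in>UNIV. d i * (v $ i)\<^sup>2)" for v
      by (simp add: mat_of_diag_sym inner_vec_def matrix_vector_mult_def if_distrib
          if_distribR power2_eq_square mult_ac cong: if_cong)
    then show ?thesis using that by (simp add: psd_cone_def sum_nonneg)
  qed
  show "conj_by P ?D \<in> psd_cone"
    by (intro psd_cone_conj_by diag_psd) simp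
  fix Z :: "'a sym_mat" assume Z: "Z \<in> psd_cone"
  define W where "W = conj_by (transpose P) Z"
  have W: "0 \<le> mat_of W $ i $ i" for i
  proof -
    have "0 \<le> axis i 1 \<bullet> (mat_of W *v axis i 1)"
      using psd_cone_conj_by [OF Z, of "transpose P"] by (simp add: psd_cone_def W_def)
    then show ?thesis by (simp add: inner_axis' matrix_vector_mult_basis column_def)
  qed
  have "conj_by P (diag_sym l) - conj_by P ?D = conj_by P (diag_sym l - ?D)"
    by (simp add: linear_diff [OF linear_conj_by])
  then have "(conj_by P (diag_sym l) - conj_by P ?D) \<bullet> (Z - conj_by P ?D)
      = (diag_sym l - ?D) \<bullet> (W - ?D)"
    by (simp only: inner_conj_by) (simp add: W_def linear_diff [OF linear_conj_by]
        conj_by_orthogonal_cancel [OF assms])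
  also have "\<dots> = (\<Sum>i\<in>UNIV. (l i - max (l i) 0) * (mat_of W $ i $ i - max (l i) 0))"
  proof -
    have "(mat_of (diag_sym l - ?D) $ i $ j) * (mat_of (W - ?D) $ i $ j)
        = (if i = j then (l i - max (l i) 0) * (mat_of W $ i $ i - max (l i) 0) else 0)" for i j
      by (simp add: mat_of_diag_sym)
    then show ?thesis by (simp add: inner_mat_of inner_vec_def)
  qed
  also have "\<dots> = (\<Sum>i\<in>UNIV. min (l i) 0 * mat_of W $ i $ i)"
    by (rule sum.cong) (auto simp: max_def min_def)
  also have "\<dots> \<le> 0"
    using W by (intro sum_nonpos mult_nonpos_nonneg) auto
  finally show "(conj_by P (diag_sym l) - conj_by P ?D) \<bullet> (Z - conj_by P ?D) \<le> 0" .
qed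

section \<open>Differentiability of the projection at nonsingular matrices\<close>

text \<open>A Hadamard multiplier in the basis \<open>P\<close>. The derivatives of the projection
  and the operators \<open>V_zero\<close> and \<open>V_id\<close> all have this shape and differ
  only in \<open>w\<close>. A symmetric \<open>w\<close> keeps the argument of \<open>sym_of\<close>
  symmetric.\<close>

definition spectral_schur ::
    "real^'n^'n \<Rightarrow> ('n \<Rightarrow> 'n \<Rightarrow> real) \<Rightarrow> 'n sym_mat \<Rightarrow> 'n::finite sym_mat"
  where "spectral_schur P w H =
    conj_by P (sym_of (\<chi> i j. w i j * mat_of (conj_by (transpose P) H) $ i $ j))"

lemma mat_of_weighted:
  assumes "\<And>i j. w i j = w j i"
  shows "mat_of (sym_of (\<chi> i j. w i j * mat_of H $ i $ j)) = (\<chi> i j. w i j * mat_of H $ i $ j)"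
proof (rule mat_of_sym_of)
  have "w j i * mat_of H $ j $ i = w i j * mat_of H $ i $ j" for i j
    unfolding assms [of j i] mat_of_sym [of H j i] ..
  then show "transpose (\<chi> i j. w i j * mat_of H $ i $ j) = (\<chi> i j. w i j * mat_of H $ i $ j)"
    unfolding transpose_def vec_eq_iff by (simp only: vec_lambda_beta) blast
qed

lemma conj_by_spectral_schur:
  assumes "orthogonal_matrix P" "\<And>i j. w i j = w j i"
  shows "mat_of (conj_by (transpose P) (spectral_schur P w H)) $ i $ j
    = w i j * mat_of (conj_by (transpose P) H) $ i $ j"
  by (simp add: spectral_schur_def conj_by_orthogonal_cancel [OF assms(1)]
      mat_of_weighted [of w, OF assms(2)])

lemma sym_mat_eq_conj_iff:
  assumes "orthogonal_matrix P"
  shows "A = B \<longleftrightarrow> (\<forall>i j. mat_of (conj_by (transpose P) A) $ i $ j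
    = mat_of (conj_by (transpose P) B) $ i $ j)"
  by (metis sym_mat_eq_iff conj_by_orthogonal_cancel(1) [OF assms])

lemmas linear_conj_by_simps =
  linear_add [OF linear_conj_by] linear_diff [OF linear_conj_by] linear_scale [OF linear_conj_by]

lemma linear_spectral_schur:
  assumes "orthogonal_matrix P" "\<And>i j. w i j = w j i"
  shows "linear (spectral_schur P w)"
  by (rule linearI; simp add: sym_mat_eq_conj_iff [OF assms(1)] linear_conj_by_simps
      conj_by_spectral_schur [OF assms] algebra_simps)

section \<open>Entrywise estimates and squares near a diagonal matrix\<close>

lemma norm_sym_mat_le:
  fixes A :: "'n::finite sym_mat"
  assumes "\<And>i j. \<bar>mat_of A $ i $ j\<bar> \<le> c"
  shows "norm A \<le> (real CARD('n))\<^sup>2 * c"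
proof -
  have "norm (mat_of A $ i) \<le> CARD('n) * c" for i
  proof -
    have "norm (mat_of A $ i) \<le> (\<Sum>j\<in>UNIV. \<bar>mat_of A $ i $ j\<bar>)" by (rule norm_le_l1_cart)
    also have "\<dots> \<le> (\<Sum>j\<in>(UNIV :: 'n set). c)" by (intro sum_mono assms)
    finally show ?thesis by simp
  qed
  moreover have "norm (mat_of A) \<le> (\<Sum>i\<in>UNIV. norm (mat_of A $ i))"
    unfolding norm_vec_def by (rule L2_set_le_sum) simp
  ultimately have "norm (mat_of A) \<le> (\<Sum>i\<in>(UNIV :: 'n set). CARD('n) * c)"
    by (meson order_trans sum_mono)
  then show ?thesis by (simp add: norm_mat_of power2_eq_square mult_ac)
qed

text \<open>By symmetry an entry of the square is an inner product of two rows, so Cauchy-Schwarz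
  applies.\<close>

lemma abs_mat_of_square_le: "\<bar>(mat_of A ** mat_of A) $ i $ j\<bar> \<le> (norm A)\<^sup>2"
proof -
  have "(mat_of A ** mat_of A) $ i $ j = mat_of A $ i \<bullet> mat_of A $ j"
    by (simp add: matrix_matrix_mult_def inner_vec_def mat_of_sym [of A j])
  then have "\<bar>(mat_of A ** mat_of A) $ i $ j\<bar> \<le> norm (mat_of A $ i) * norm (mat_of A $ j)"
    by (simp add: Cauchy_Schwarz_ineq2)
  also have "\<dots> \<le> norm A * norm A"
    by (intro mult_mono) (simp_all add: norm_mat_of [symmetric] Finite_Cartesian_Product.norm_nth_le)
  finally show ?thesis by (simp add: power2_eq_square)
qed

lemma diag_sym_mult_nth:
  "(mat_of (diag_sym d) ** M) $ i $ j = d i * M $ i $ j"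
  "(M ** mat_of (diag_sym d)) $ i $ j = d j * M $ i $ j"
proof -
  have "(mat_of (diag_sym d) ** M) $ i $ j = (\<Sum>k\<in>UNIV. if k = i then d i * M $ i $ j else 0)"
    unfolding matrix_matrix_mult_def vec_lambda_beta
    by (rule sum.cong) (auto simp: mat_of_diag_sym)
  then show "(mat_of (diag_sym d) ** M) $ i $ j = d i * M $ i $ j" by simp
  have "(M ** mat_of (diag_sym d)) $ i $ j = (\<Sum>k\<in>UNIV. if k = j then d j * M $ i $ j else 0)"
    unfolding matrix_matrix_mult_def vec_lambda_beta
    by (rule sum.cong) (auto simp: mat_of_diag_sym)
  then show "(M ** mat_of (diag_sym d)) $ i $ j = d j * M $ i $ j" by simp
qed

text \<open>The linear part DE + ED acts on entry (i, j) as multiplication by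
  \<open>d i + d j\<close>. A relation between squares can therefore be solved for \<open>E\<close>
  by division, up to quadratic terms.\<close>

lemma diag_plus_square_nth:
  "(mat_of (diag_sym d + E) ** mat_of (diag_sym d + E)) $ i $ j
    = (if i = j then (d i)\<^sup>2 else 0) + (d i + d j) * mat_of E $ i $ j + (mat_of E ** mat_of E) $ i $ j"
  by (simp add: matrix_mult_distrib diag_sym_mult_nth distrib_right)
    (simp add: mat_of_diag_sym power2_eq_square)

text \<open>For \<open>l i \<noteq> l j\<close> this is the divided difference of max(., 0) at the
  two eigenvalues; for equal nonzero ones it is the derivative. If both vanish, division by zero
  yields 1/2, a value that \<open>block_weight\<close> replaces.\<close>

definition projection_weight :: "('n \<Rightarrow> real) \<Rightarrow> 'n \<Rightarrow> 'n \<Rightarrow> real"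
  where "projection_weight l i j = (1 + (l i + l j) / (\<bar>l i\<bar> + \<bar>l j\<bar>)) / 2"

lemma projection_weight_commute: "projection_weight l i j = projection_weight l j i"
  by (simp add: projection_weight_def add.commute)

text \<open>
  The matrix \<open>2 \<Pi>(Y) - Y\<close> is the absolute value of \<open>Y\<close>. Comparing the squares of the absolute
  values of two matrices in an eigenbasis of the first one determines their difference up to
  second order.
\<close>

lemma psd_projection_expansion:
  fixes P :: "real^'n^'n" and Y :: "'n::finite sym_mat"
  assumes P: "orthogonal_matrix P" and l: "\<And>i. l i \<noteq> 0"
  defines "A \<equiv> conj_by P (diag_sym l)"
  shows "\<bar>mat_of (conj_by (transpose P) (closest_point psd_cone Y - closest_point psd_cone A
      - spectral_schur P (projection_weight l) (Y - A))) $ i $ j\<bar>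
    \<le> 5 * (norm (Y - A))\<^sup>2 / (\<bar>l i\<bar> + \<bar>l j\<bar>)"
proof -
  let ?pi = "closest_point psd_cone :: 'n sym_mat \<Rightarrow> _" and ?c = "conj_by (transpose P)"
  define K where "K = ?c (Y - A)"
  define E where "E = ?c (2 *\<^sub>R (?pi Y - ?pi A) - (Y - A))"
  have cA: "?c A = diag_sym l"
    by (simp add: A_def conj_by_orthogonal_cancel [OF P])
  have cpA: "?c (2 *\<^sub>R ?pi A - A) = diag_sym (\<lambda>i. \<bar>l i\<bar>)"
    by (simp add: A_def psd_projection_diagonal [OF P] linear_conj_by_simps
        conj_by_orthogonal_cancel [OF P])
      (auto simp add: sym_mat_eq_iff mat_of_diag_sym max_def)
  have cY: "?c Y = diag_sym l + K"
    by (simp add: K_def linear_conj_by_simps cA)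
  have cM: "?c (2 *\<^sub>R ?pi Y - Y) = diag_sym (\<lambda>i. \<bar>l i\<bar>) + E"
    unfolding cpA [symmetric] by (simp add: E_def linear_conj_by_simps algebra_simps)
  \<comment> \<open>Orthogonal congruence commutes with squaring, so equality of the squares carries
    over to the eigenbasis of \<open>A\<close>.\<close>
  have sq: "mat_of (?c X) ** mat_of (?c X) = transpose P ** (mat_of X ** mat_of X) ** P" for X
    using P by (simp add: mat_of_conj_by orthogonal_matrix_def)
      (metis matrix_mul_assoc matrix_mul_rid)
  have "mat_of (?c (2 *\<^sub>R ?pi Y - Y)) ** mat_of (?c (2 *\<^sub>R ?pi Y - Y)) = mat_of (?c Y) ** mat_of (?c Y)"
    unfolding sq psd_projection_square ..
  then have "(\<bar>l i\<bar> + \<bar>l j\<bar>) * mat_of E $ i $ j + (mat_of E ** mat_of E) $ i $ j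
      = (l i + l j) * mat_of K $ i $ j + (mat_of K ** mat_of K) $ i $ j"
    unfolding cM cY
    using diag_plus_square_nth [of "\<lambda>i. \<bar>l i\<bar>" E i j] diag_plus_square_nth [of l K i j]
    by (simp split: if_splits)
  then have eq: "(\<bar>l i\<bar> + \<bar>l j\<bar>) * mat_of E $ i $ j - (l i + l j) * mat_of K $ i $ j
      = (mat_of K ** mat_of K) $ i $ j - (mat_of E ** mat_of E) $ i $ j"
    by linarith
  have pos: "\<bar>l i\<bar> + \<bar>l j\<bar> > 0" using l [of i] by simp
  have nK: "norm K = norm (Y - A)"
    by (simp add: K_def norm_conj_by_orthogonal [OF P])
  have "norm E = norm (2 *\<^sub>R (?pi Y - ?pi A) - (Y - A))"
    by (simp add: E_def norm_conj_by_orthogonal [OF P])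
  also have "\<dots> \<le> norm (2 *\<^sub>R (?pi Y - ?pi A)) + norm (Y - A)"
    by (rule norm_triangle_ineq4)
  \<comment> \<open>The projection is nonexpansive, hence 3 = 2 + 1. After squaring, the two
    quadratic remainders add up to at most 9 + 1 = 10, and halving at the end leaves the constant
    5.\<close>
  also have "\<dots> \<le> 3 * norm (Y - A)"
    using closest_point_lipschitz [OF convex_psd_cone closed_psd_cone, of Y A] zero_in_psd_cone
    by (auto simp: dist_norm)
  finally have "(norm E)\<^sup>2 \<le> (3 * norm (Y - A))\<^sup>2"
    by (rule power_mono) simp
  then have sq_bound: "\<bar>(mat_of K ** mat_of K) $ i $ j - (mat_of E ** mat_of E) $ i $ j\<bar>
      \<le> 10 * (norm (Y - A))\<^sup>2"
    using abs_mat_of_square_le [of K i j] abs_mat_of_square_le [of E i j]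
    by (simp add: nK power_mult_distrib)
  have "?c (2 *\<^sub>R (?pi Y - ?pi A - spectral_schur P (projection_weight l) (Y - A)))
      = E + K - 2 *\<^sub>R ?c (spectral_schur P (projection_weight l) (Y - A))"
    by (simp add: E_def K_def linear_conj_by_simps algebra_simps scaleR_2)
  then have "2 * mat_of (?c (?pi Y - ?pi A - spectral_schur P (projection_weight l) (Y - A))) $ i $ j
      = mat_of E $ i $ j + mat_of K $ i $ j - 2 * (projection_weight l i j * mat_of K $ i $ j)"
    using conj_by_spectral_schur [OF P, of "projection_weight l" "Y - A" i j]
      projection_weight_commute [of l]
    unfolding sym_mat_eq_iff
    by (simp add: linear_conj_by_simps K_def)
  also have "\<dots> = ((\<bar>l i\<bar> + \<bar>l j\<bar>) * mat_of E $ i $ j - (l i + l j) * mat_of K $ i $ j)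
      / (\<bar>l i\<bar> + \<bar>l j\<bar>)"
    using pos by (simp add: projection_weight_def field_simps)
  finally have "2 * \<bar>mat_of (?c (?pi Y - ?pi A - spectral_schur P (projection_weight l) (Y - A))) $ i $ j\<bar>
      = \<bar>(mat_of K ** mat_of K) $ i $ j - (mat_of E ** mat_of E) $ i $ j\<bar> / (\<bar>l i\<bar> + \<bar>l j\<bar>)"
    unfolding eq using pos by (metis abs_divide abs_mult abs_numeral abs_of_pos)
  also have "\<dots> \<le> 10 * (norm (Y - A))\<^sup>2 / (\<bar>l i\<bar> + \<bar>l j\<bar>)"
    using sq_bound pos by (intro divide_right_mono) auto
  finally show ?thesis by simp
qed

text \<open>The expansion has a quadratic remainder in every entry. All \<open>l i\<close> are
  nonzero and there are finitely many, so the denominators have the common positive lower bound 2c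
  and the remainder is quadratic in norm.\<close>

lemma has_derivative_psd_projection:
  fixes P :: "real^'n^'n::finite"
  assumes P: "orthogonal_matrix P" and l: "\<And>i. l i \<noteq> 0"
  shows "(closest_point psd_cone has_derivative spectral_schur P (projection_weight l))
    (at (conj_by P (diag_sym l)))"
proof -
  define A where "A = conj_by P (diag_sym l)"
  define c where "c = Min (range (\<lambda>i. \<bar>l i\<bar>))"
  have c: "0 < c" unfolding c_def using l by (subst Min_gr_iff) auto
  have "c \<le> \<bar>l i\<bar>" for i
    unfolding c_def by (rule Min_le) auto
  then have cl: "2 * c \<le> \<bar>l i\<bar> + \<bar>l j\<bar>" for i j
    by (metis add_mono mult_2)
  define C where "C = (real CARD('n))\<^sup>2 * (5 / (2 * c))"
  have "((closest_point psd_cone) has_derivative spectral_schur P (projection_weight l)) (at A)"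
  proof (rule has_derivativeI_sandwich [of 1])
    show "bounded_linear (spectral_schur P (projection_weight l))"
      by (intro linear_spectral_schur [OF P] projection_weight_commute
          linear_conv_bounded_linear [THEN iffD1])
    fix Y :: "'n sym_mat" assume "Y \<noteq> A"
    let ?R = "closest_point psd_cone Y - closest_point psd_cone A
        - spectral_schur P (projection_weight l) (Y - A)"
    have "\<bar>mat_of (conj_by (transpose P) ?R) $ i $ j\<bar> \<le> 5 * (norm (Y - A))\<^sup>2 / (2 * c)" for i j
    proof -
      have "\<bar>mat_of (conj_by (transpose P) ?R) $ i $ j\<bar>
          \<le> 5 * (norm (Y - A))\<^sup>2 / (\<bar>l i\<bar> + \<bar>l j\<bar>)"
        unfolding A_def by (rule psd_projection_expansion [where l = l, OF P l])
      also have "\<dots> \<le> 5 * (norm (Y - A))\<^sup>2 / (2 * c)"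
        using cl [of i j] c by (intro divide_left_mono mult_pos_pos) auto
      finally show ?thesis .
    qed
    then have "norm (conj_by (transpose P) ?R) \<le> (real CARD('n))\<^sup>2 * (5 * (norm (Y - A))\<^sup>2 / (2 * c))"
      by (rule norm_sym_mat_le)
    then have "norm ?R \<le> C * norm (Y - A) * norm (Y - A)"
      by (simp add: norm_conj_by_orthogonal [OF P] C_def power2_eq_square)
    then show "norm ?R / norm (Y - A) \<le> C * norm (Y - A)"
      using \<open>Y \<noteq> A\<close> by (simp add: divide_le_eq)
  next
    show "((\<lambda>Y. C * norm (Y - A)) \<longlongrightarrow> 0) (at A)"
      by (auto intro!: tendsto_eq_intros)
  qed simp
  then show ?thesis by (simp add: A_def)
qed

section \<open>The KKT residual and its Bouligand subdifferential\<close>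

lemma inner_sum_Basis_linear:
  fixes \<phi> :: "'a::euclidean_space \<Rightarrow> real"
  assumes "linear \<phi>" shows "d \<bullet> (\<Sum>b\<in>Basis. \<phi> b *\<^sub>R b) = \<phi> d"
proof -
  have "\<phi> d = \<phi> (\<Sum>b\<in>Basis. (d \<bullet> b) *\<^sub>R b)" by (simp add: euclidean_representation)
  also have "\<dots> = (\<Sum>b\<in>Basis. (d \<bullet> b) * \<phi> b)"
    by (simp add: linear_sum [OF assms] linear_scale [OF assms])
  finally show ?thesis by (simp add: inner_sum_right mult.commute)
qed

text \<open>In this form the adjoint terms of \<open>U_of\<close> can be matched coordinate by
  coordinate with the derivative of the Lagrangian gradient.\<close>

lemma adjoint_eq_sum_Basis:
  fixes T :: "'a::euclidean_space \<Rightarrow> 'b::euclidean_space"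
  assumes "linear T" shows "adjoint T y = (\<Sum>b\<in>Basis. (y \<bullet> T b) *\<^sub>R b)"
proof -
  have "linear (\<lambda>d. y \<bullet> T d)"
    by (rule linearI) (simp_all add: linear_add [OF assms] linear_scale [OF assms] inner_add_right)
  from inner_sum_Basis_linear [OF this] have "d \<bullet> adjoint T y = d \<bullet> (\<Sum>b\<in>Basis. (y \<bullet> T b) *\<^sub>R b)" for d
    by (simp add: adjoint_works [OF assms] inner_commute)
  then show ?thesis by (metis vector_eq_ldot)
qed

lemma gradient_eqI:
  assumes "GDERIV \<phi> x :> d" shows "gradient \<phi> x = d"
  unfolding gradient_def
proof (rule the_equality [where P = "\<lambda>d. GDERIV \<phi> x :> d", OF assms])
  fix e assume "GDERIV \<phi> x :> e"
  with assms have "(\<lambda>h. h \<bullet> e) = (\<lambda>h. h \<bullet> d)"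
    unfolding gderiv_def by (rule has_derivative_unique [rotated])
  then show "e = d" by (metis vector_eq_ldot)
qed

text \<open>The linear map \<open>p\<close> lets one rule serve twice: with the identity for
  derivatives in x alone, and with \<open>fst\<close> for derivatives on the product space.\<close>

lemma has_derivative_blinfun_apply_compose:
  assumes "(D has_derivative blinfun_apply D2) (at (p z))" "bounded_linear p"
  shows "((\<lambda>z. blinfun_apply (D (p z)) b) has_derivative (\<lambda>dz. blinfun_apply (D2 (p dz)) b)) (at z)"
proof -
  have "((\<lambda>z. D (p z)) has_derivative (\<lambda>dz. D2 (p dz))) (at z)"
    using has_derivative_compose [OF bounded_linear_imp_has_derivative [OF assms(2)] assms(1)] .
  then show ?thesis
    by (rule bounded_linear.has_derivative [OF blinfun.bounded_linear_left])
qed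

section \<open>Limits of the multipliers and the blocks of \<open>V_zero\<close> and
  \<open>V_id\<close>\<close>

lemma tendsto_sym_mat_iff:
  fixes A :: "'n::finite sym_mat"
  shows "(X \<longlongrightarrow> A) F \<longleftrightarrow> ((\<lambda>k. mat_of (X k)) \<longlongrightarrow> mat_of A) F"
proof -
  have "dist (mat_of A) (mat_of B) = dist A B" for A B :: "'n sym_mat"
    by (metis dist_norm mat_of_minus norm_mat_of)
  then show ?thesis by (simp add: tendsto_iff)
qed

lemma tendsto_spectral_schur:
  fixes w :: "'k \<Rightarrow> 'n \<Rightarrow> 'n::finite \<Rightarrow> real"
  assumes "\<And>k i j. w k i j = w k j i" "\<And>i j. ((\<lambda>k. w k i j) \<longlongrightarrow> v i j) F"
    and "\<And>i j. v i j = v j i"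
  shows "((\<lambda>k. spectral_schur P (w k) H) \<longlongrightarrow> spectral_schur P v H) F"
proof -
  have mat: "mat_of (spectral_schur P u H)
      = P ** (\<chi> i j. u i j * mat_of (conj_by (transpose P) H) $ i $ j) ** transpose P"
    if "\<And>i j. u i j = u j i" for u
    unfolding spectral_schur_def mat_of_conj_by [of P "sym_of _"]
    by (simp only: mat_of_weighted [of u, OF that])
  show ?thesis
    unfolding tendsto_sym_mat_iff mat [of "w _", OF assms(1)] mat [of v, OF assms(3)]
    unfolding matrix_matrix_mult_def
    by (intro tendsto_vec_lambda) (auto intro!: tendsto_intros tendsto_sum assms(2))
qed

text \<open>The parameter \<open>s\<close> interpolates affinely: 0 gives \<open>V_zero\<close>, 1
  gives \<open>V_id\<close>, and \<open>1 - t\<close> gives their convex combination with weight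
  \<open>t\<close> on \<open>V_zero\<close>.\<close>

definition block_weight :: "('n \<Rightarrow> real) \<Rightarrow> real \<Rightarrow> 'n \<Rightarrow> 'n \<Rightarrow> real"
  where "block_weight lam s i j =
    (if lam i = 0 \<and> lam j = 0 then s else projection_weight lam i j)"

lemma block_weight_commute: "block_weight lam s i j = block_weight lam s j i"
  by (simp add: block_weight_def projection_weight_commute [of lam i])

text \<open>Off the zero block the projection weight is 1, 0 or the quotient \<open>Xi\<close>,
  according to the signs of the two eigenvalues; this is the prescribed block pattern.\<close>

lemma block_mat_eq: "block_mat lam s H = (\<chi> i j. block_weight lam s i j * mat_of H $ i $ j)"
proof -
  have "block_mat lam s H $ i $ j = block_weight lam s i j * mat_of H $ i $ j" for i j
    by (cases "lam i" "0 :: real" rule: linorder_cases;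
        cases "lam j" "0 :: real" rule: linorder_cases)
      (simp_all add: block_mat_def block_weight_def projection_weight_def Xi_def ix_pos_def
        ix_zero_def ix_neg_def field_simps)
  then show ?thesis by (simp add: vec_eq_iff)
qed

lemma V_zero_eq: "V_zero P lam = spectral_schur P (block_weight lam 0)"
  and V_id_eq: "V_id P lam = spectral_schur P (block_weight lam 1)"
  by (simp_all add: fun_eq_iff V_zero_def V_id_def spectral_schur_def block_mat_eq)

text \<open>If both eigenvalues vanish, the perturbed weight is constant, since the quotient of
  \<open>2 * \<sigma> * eps k\<close> by \<open>2 * eps k\<close> is \<open>\<sigma>\<close>.
  Otherwise the denominator has a nonzero limit and the weight is continuous there.\<close>

lemma tendsto_projection_weight_perturbed:
  assumes "\<sigma> = 1 \<or> \<sigma> = -1" and eps: "eps \<longlonglongrightarrow> 0" "\<And>k :: nat. 0 < eps k"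
  shows "(\<lambda>k. projection_weight (\<lambda>i. lam i + (if lam i = 0 then \<sigma> * eps k else 0)) i j)
    \<longlonglongrightarrow> block_weight lam ((1 + \<sigma>) / 2) i j"
proof (cases "lam i = 0 \<and> lam j = 0")
  case True
  have "projection_weight (\<lambda>i. lam i + (if lam i = 0 then \<sigma> * eps k else 0)) i j = (1 + \<sigma>) / 2" for k
    using True assms(1) eps(2) [of k] by (auto simp: projection_weight_def)
  then show ?thesis using True unfolding block_weight_def by (simp only: if_True) simp
next
  case False
  have lim: "(\<lambda>k. lam i + (if lam i = 0 then \<sigma> * eps k else 0)) \<longlonglongrightarrow> lam i" for i
    using tendsto_mult_right_zero [OF eps(1), of \<sigma>]
    by (cases "lam i = 0") (auto intro!: tendsto_eq_intros)
  have "\<bar>lam i\<bar> + \<bar>lam j\<bar> \<noteq> 0" using False by linarith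
  then show ?thesis
    using False unfolding block_weight_def projection_weight_def
    by (simp only: if_False) (intro tendsto_intros lim; simp)
qed

text \<open>Derivatives are fields of bounded operators, so evaluating in a fixed direction is
  itself bounded linear. In \<open>D2f x d b\<close> the field \<open>Df\<close> is differentiated
  along \<open>d\<close> and the result applied to \<open>b\<close>.\<close>

locale smooth_nlsdp =
  fixes f :: "'a::euclidean_space \<Rightarrow> real"
    and h :: "'a \<Rightarrow> real^'m"
    and g :: "'a \<Rightarrow> 'n::finite sym_mat"
    and Df D2f Dh D2h Dg D2g
  assumes Df: "\<And>x. (f has_derivative blinfun_apply (Df x)) (at x)"
    and D2f: "\<And>x. (Df has_derivative blinfun_apply (D2f x)) (at x)"
    and Dh: "\<And>x. (h has_derivative blinfun_apply (Dh x)) (at x)"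
    and D2h: "\<And>x. (Dh has_derivative blinfun_apply (D2h x)) (at x)"
    and Dg: "\<And>x. (g has_derivative blinfun_apply (Dg x)) (at x)"
    and D2g: "\<And>x. (Dg has_derivative blinfun_apply (D2g x)) (at x)"
begin

lemma frechet_h: "frechet_derivative h (at x) = blinfun_apply (Dh x)"
  and frechet_g: "frechet_derivative g (at x) = blinfun_apply (Dg x)"
  using frechet_derivative_at [OF Dh] frechet_derivative_at [OF Dg] by simp_all

lemma has_derivative_lagrangian:
  "((\<lambda>y. lagrangian f h g y \<xi> \<Gamma>) has_derivative (\<lambda>d. Df x d + \<xi> \<bullet> Dh x d + \<Gamma> \<bullet> Dg x d)) (at x)"
  unfolding lagrangian_def
  by (intro has_derivative_add has_derivative_inner_right Df Dh Dg)

lemma inner_grad_lagrangian: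
    "d \<bullet> grad_lagrangian f h g x \<xi> \<Gamma> = Df x d + \<xi> \<bullet> Dh x d + \<Gamma> \<bullet> Dg x d"
  and grad_lagrangian_eq:
    "grad_lagrangian f h g x \<xi> \<Gamma> = (\<Sum>b\<in>Basis. (Df x b + \<xi> \<bullet> Dh x b + \<Gamma> \<bullet> Dg x b) *\<^sub>R b)"
proof -
  have lin: "linear (\<lambda>d. Df x d + \<xi> \<bullet> Dh x d + \<Gamma> \<bullet> Dg x d)"
    using has_derivative_lagrangian has_derivative_linear by blast
  show eq: "grad_lagrangian f h g x \<xi> \<Gamma> = (\<Sum>b\<in>Basis. (Df x b + \<xi> \<bullet> Dh x b + \<Gamma> \<bullet> Dg x b) *\<^sub>R b)"
    by (rule gradient_eqI)
      (simp add: gderiv_def inner_sum_Basis_linear [OF lin] has_derivative_lagrangian)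
  show "d \<bullet> grad_lagrangian f h g x \<xi> \<Gamma> = Df x d + \<xi> \<bullet> Dh x d + \<Gamma> \<bullet> Dg x d"
    unfolding eq by (rule inner_sum_Basis_linear [OF lin])
qed

lemma has_derivative_grad_lagrangian:
    "((\<lambda>y. grad_lagrangian f h g y \<xi> \<Gamma>) has_derivative hess_lagrangian f h g x \<xi> \<Gamma>) (at x)"
  and hess_lagrangian_eq:
    "hess_lagrangian f h g x \<xi> \<Gamma> d
      = (\<Sum>b\<in>Basis. (D2f x d b + \<xi> \<bullet> D2h x d b + \<Gamma> \<bullet> D2g x d b) *\<^sub>R b)"
proof -
  note comp = has_derivative_blinfun_apply_compose [where p = "\<lambda>x. x", OF _ bounded_linear_ident]
  note D2 = comp [where D = Df, OF D2f] comp [where D = Dh, OF D2h] comp [where D = Dg, OF D2g]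
  have "((\<lambda>y. grad_lagrangian f h g y \<xi> \<Gamma>) has_derivative
      (\<lambda>d. \<Sum>b\<in>Basis. (D2f x d b + \<xi> \<bullet> D2h x d b + \<Gamma> \<bullet> D2g x d b) *\<^sub>R b)) (at x)"
    unfolding grad_lagrangian_eq
    by (intro has_derivative_sum has_derivative_scaleR_left has_derivative_add
        has_derivative_inner_right D2)
  moreover from this have "hess_lagrangian f h g x \<xi> \<Gamma>
      = (\<lambda>d. \<Sum>b\<in>Basis. (D2f x d b + \<xi> \<bullet> D2h x d b + \<Gamma> \<bullet> D2g x d b) *\<^sub>R b)"
    unfolding hessian_def by (rule frechet_derivative_at [symmetric])
  ultimately show "((\<lambda>y. grad_lagrangian f h g y \<xi> \<Gamma>) has_derivative hess_lagrangian f h g x \<xi> \<Gamma>) (at x)"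
    and "hess_lagrangian f h g x \<xi> \<Gamma> d
      = (\<Sum>b\<in>Basis. (D2f x d b + \<xi> \<bullet> D2h x d b + \<Gamma> \<bullet> D2g x d b) *\<^sub>R b)"
    by simp_all
qed

text \<open>The product rule splits each coordinate of the first component into a Hessian part and a
  part linear in the multiplier increments. The latter consists of coordinates of the two
  adjoints.\<close>

lemma has_derivative_kkt_residual:
  assumes V: "(closest_point psd_cone has_derivative V) (at (g x + \<Gamma>))"
  shows "(kkt_residual f h g has_derivative U_of V f h g x \<xi> \<Gamma>) (at (x, \<xi>, \<Gamma>))"
proof -
  let ?z = "(x, \<xi>, \<Gamma>)"
  have fst: "bounded_linear (fst :: 'a \<times> (real^'m) \<times> 'n sym_mat \<Rightarrow> 'a)"
    by (rule bounded_linear_fst)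
  have xi: "((\<lambda>z. fst (snd z)) has_derivative (\<lambda>z. fst (snd z))) (at ?z)"
    and Ga: "((\<lambda>z. snd (snd z)) has_derivative (\<lambda>z. snd (snd z))) (at ?z)"
    by (auto intro!: derivative_eq_intros)
  note comp = has_derivative_blinfun_apply_compose [where p = fst and z = ?z, OF _ fst]
  note D2 = comp [where D = Df and ?D2.0 = "D2f x"] comp [where D = Dh and ?D2.0 = "D2h x"]
    comp [where D = Dg and ?D2.0 = "D2g x"]
  have G: "((\<lambda>z. grad_lagrangian f h g (fst z) (fst (snd z)) (snd (snd z))) has_derivative
      (\<lambda>d. \<Sum>b\<in>Basis. (D2f x (fst d) b
        + (fst (snd ?z) \<bullet> D2h x (fst d) b + fst (snd d) \<bullet> Dh (fst ?z) b)
        + (snd (snd ?z) \<bullet> D2g x (fst d) b + snd (snd d) \<bullet> Dg (fst ?z) b)) *\<^sub>R b)) (at ?z)"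
    unfolding grad_lagrangian_eq
    by (intro has_derivative_sum has_derivative_scaleR_left has_derivative_add
        has_derivative_inner xi Ga D2; simp add: D2f D2h D2g)
  have H: "((\<lambda>z. h (fst z)) has_derivative (\<lambda>d. Dh x (fst d))) (at ?z)"
    and Gg: "((\<lambda>z. g (fst z)) has_derivative (\<lambda>d. Dg x (fst d))) (at ?z)"
    using Dh Dg by (auto intro!: has_derivative_compose [OF bounded_linear_imp_has_derivative [OF fst]])
  have Pi: "((\<lambda>z. closest_point psd_cone (g (fst z) + snd (snd z))) has_derivative
      (\<lambda>d. V (Dg x (fst d) + snd (snd d)))) (at ?z)"
    using has_derivative_compose [OF has_derivative_add [OF Gg Ga], of "closest_point psd_cone" V] V
    by simp
  have res: "kkt_residual f h g = (\<lambda>z. (grad_lagrangian f h g (fst z) (fst (snd z)) (snd (snd z)),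
      h (fst z), - g (fst z) + closest_point psd_cone (g (fst z) + snd (snd z))))"
    by (simp add: kkt_residual_def fun_eq_iff)
  have lin: "linear (blinfun_apply (Dh x))" "linear (blinfun_apply (Dg x))"
    by (simp_all add: blinfun.bounded_linear_right bounded_linear.linear)
  have U: "U_of V f h g x \<xi> \<Gamma> = (\<lambda>d. ((\<Sum>b\<in>Basis. (D2f x (fst d) b
        + (fst (snd ?z) \<bullet> D2h x (fst d) b + fst (snd d) \<bullet> Dh (fst ?z) b)
        + (snd (snd ?z) \<bullet> D2g x (fst d) b + snd (snd d) \<bullet> Dg (fst ?z) b)) *\<^sub>R b),
      Dh x (fst d), - Dg x (fst d) + V (Dg x (fst d) + snd (snd d))))"
    by (simp add: U_of_def fun_eq_iff frechet_h frechet_g hess_lagrangian_eq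
        adjoint_eq_sum_Basis lin sum.distrib [symmetric] scaleR_left_distrib [symmetric] ac_simps)
  show ?thesis
    unfolding res U
    by (intro has_derivative_Pair has_derivative_add has_derivative_minus G H Gg Pi)
qed

text \<open>The Hessian depends on the multiplier too. Its coordinate formula is affine in \<Gamma>,
  so it converges along with \<open>Ga\<close>.\<close>

lemma tendsto_U_of:
  assumes "Ga \<longlonglongrightarrow> \<Gamma>" "\<And>H. (\<lambda>k. V k H) \<longlonglongrightarrow> W H"
  shows "(\<lambda>k. U_of (V k) f h g x \<xi> (Ga k) z) \<longlonglongrightarrow> U_of W f h g x \<xi> \<Gamma> z"
  unfolding U_of_def hess_lagrangian_eq split_beta
  by (intro tendsto_intros assms)

lemma linear_U_of:
  assumes "linear V" shows "linear (U_of V f h g x \<xi> \<Gamma>)"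
proof -
  have [simp]: "linear (blinfun_apply (Dh x))" "linear (blinfun_apply (Dg x))"
    by (simp_all add: blinfun.bounded_linear_right bounded_linear.linear)
  have "linear (hess_lagrangian f h g x \<xi> \<Gamma>)"
    using has_derivative_grad_lagrangian has_derivative_linear by blast
  then show ?thesis
    using assms
    by (intro linearI) (auto simp: U_of_def frechet_h frechet_g linear_add linear_scale
        adjoint_linear blinfun.add_right blinfun.scaleR_right algebra_simps)
qed

text \<open>The sign \<open>\<sigma> = -1\<close> makes the zero eigenvalues negative and yields
  \<open>V_zero\<close>; \<open>\<sigma> = 1\<close> makes them positive and yields
  \<open>V_id\<close>.\<close>

lemma bouligand_U_of:
  assumes P: "orthogonal_matrix P" and A: "g x + \<Gamma> = conj_by P (diag_sym lam)"
    and \<sigma>: "\<sigma> = 1 \<or> \<sigma> = -1"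
  fixes \<xi>
  defines "U \<equiv> U_of (spectral_schur P (block_weight lam ((1 + \<sigma>) / 2))) f h g x \<xi> \<Gamma>"
  shows "bounded_linear U" "Blinfun U \<in> bouligand_subdifferential (kkt_residual f h g) (x, \<xi>, \<Gamma>)"
proof -
  define eps where "eps k = inverse (real (Suc k))" for k
  have eps: "eps \<longlonglongrightarrow> 0" "\<And>k. 0 < eps k"
    unfolding eps_def by (rule LIMSEQ_inverse_real_of_nat) simp
  define l where "l k i = lam i + (if lam i = 0 then \<sigma> * eps k else 0)" for k i
  \<comment> \<open>The perturbation is diagonal in the same basis, so \<open>P\<close> still
    diagonalizes \<open>g x + G k\<close>, now with nonzero eigenvalues only.\<close>
  define G where "G k = \<Gamma> + conj_by P (eps k *\<^sub>R diag_sym (\<lambda>i. if lam i = 0 then \<sigma> else 0))" for k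
  have gG: "g x + G k = conj_by P (diag_sym (l k))" for k
  proof -
    have "diag_sym lam + eps k *\<^sub>R diag_sym (\<lambda>i. if lam i = 0 then \<sigma> else 0) = diag_sym (l k)"
      by (simp add: sym_mat_eq_iff mat_of_diag_sym l_def)
    moreover have "g x + G k = conj_by P (diag_sym lam) + conj_by P (eps k *\<^sub>R diag_sym (\<lambda>i. if lam i = 0 then \<sigma> else 0))"
      by (simp add: G_def A [symmetric])
    ultimately show ?thesis
      by (simp only: linear_add [OF linear_conj_by, symmetric])
  qed
  have lnz: "l k i \<noteq> 0" for k i
    using \<sigma> eps(2) [of k] by (auto simp: l_def)
  have Glim: "G \<longlonglongrightarrow> \<Gamma>"
    unfolding G_def linear_scale [OF linear_conj_by]
    by (rule tendsto_eq_intros eps refl | simp)+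
  define T where "T k = U_of (spectral_schur P (projection_weight (l k))) f h g x \<xi> (G k)" for k
  have T: "(kkt_residual f h g has_derivative T k) (at (x, \<xi>, G k))" for k
    unfolding T_def
    by (rule has_derivative_kkt_residual) (simp add: gG has_derivative_psd_projection [OF P lnz])
  then have Tb: "blinfun_apply (Blinfun (T k)) = T k" for k
    by (intro bounded_linear_Blinfun_apply) (rule has_derivative_bounded_linear)
  show Ub: "bounded_linear U"
    unfolding U_def linear_conv_bounded_linear [symmetric]
    by (intro linear_U_of linear_spectral_schur [OF P] block_weight_commute)
  have "(\<lambda>k. T k z) \<longlonglongrightarrow> U z" for z
    unfolding T_def U_def
    by (intro tendsto_U_of Glim tendsto_spectral_schur projection_weight_commute block_weight_commute)
      (unfold l_def, rule tendsto_projection_weight_perturbed [OF \<sigma> eps])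
  \<comment> \<open>In finite dimensions pointwise convergence of linear operators is norm
    convergence.\<close>
  then have "(\<lambda>k. Blinfun (T k)) \<longlonglongrightarrow> Blinfun U"
    by (intro tendsto_componentwise1) (simp add: Tb bounded_linear_Blinfun_apply [OF Ub])
  moreover have "(\<lambda>k. (x, \<xi>, G k)) \<longlonglongrightarrow> (x, \<xi>, \<Gamma>)"
    by (intro tendsto_intros Glim)
  ultimately show "Blinfun U \<in> bouligand_subdifferential (kkt_residual f h g) (x, \<xi>, \<Gamma>)"
    unfolding bouligand_subdifferential_def
    using T by (auto simp: Tb intro!: exI [of _ "\<lambda>k. (x, \<xi>, G k)"] exI [of _ "\<lambda>k. Blinfun (T k)"])
qed

text \<open>\<open>U_of\<close> is affine in its operator argument and the weights are affine in the
  zero-block scalar, so the combination is again a single \<open>U_of\<close>.\<close>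

lemma U_of_convex_combination:
  assumes P: "orthogonal_matrix P"
  shows "t *\<^sub>R U_of (V_zero P lam) f h g x \<xi> \<Gamma> z + (1 - t) *\<^sub>R U_of (V_id P lam) f h g x \<xi> \<Gamma> z
    = U_of (spectral_schur P (block_weight lam (1 - t))) f h g x \<xi> \<Gamma> z"
proof -
  have V: "spectral_schur P (block_weight lam (1 - t)) H
      = t *\<^sub>R V_zero P lam H + (1 - t) *\<^sub>R V_id P lam H" for H
    by (simp add: sym_mat_eq_conj_iff [OF P] V_zero_eq V_id_eq linear_conj_by_simps
        conj_by_spectral_schur [OF P block_weight_commute])
      (simp add: block_weight_def algebra_simps)
  show ?thesis
    by (cases z) (simp add: U_of_def V algebra_simps scaleR_diff_left)
qed

lemma clarke_U_of:
  assumes P: "orthogonal_matrix P" and A: "g x + \<Gamma> = conj_by P (diag_sym lam)"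
    and t: "t \<in> {0<..<1}"
  shows "U_of (spectral_schur P (block_weight lam (1 - t))) f h g x \<xi> \<Gamma>
    \<in> blinfun_apply ` clarke_subdifferential (kkt_residual f h g) (x, \<xi>, \<Gamma>)"
proof -
  let ?S = "bouligand_subdifferential (kkt_residual f h g) (x, \<xi>, \<Gamma>)"
  let ?U = "\<lambda>V. U_of V f h g x \<xi> \<Gamma>"
  have 0: "bounded_linear (?U (V_zero P lam))" "Blinfun (?U (V_zero P lam)) \<in> ?S"
    using bouligand_U_of [OF P A, of "-1" \<xi>] by (simp_all add: V_zero_eq)
  have 1: "bounded_linear (?U (V_id P lam))" "Blinfun (?U (V_id P lam)) \<in> ?S"
    using bouligand_U_of [OF P A, of 1 \<xi>] by (simp_all add: V_id_eq)
  have "t *\<^sub>R Blinfun (?U (V_zero P lam)) + (1 - t) *\<^sub>R Blinfun (?U (V_id P lam)) \<in> convex hull ?S"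
    using t by (intro convexD [OF convex_convex_hull] hull_inc 0 1) auto
  moreover have "blinfun_apply (t *\<^sub>R Blinfun (?U (V_zero P lam)) + (1 - t) *\<^sub>R Blinfun (?U (V_id P lam)))
      = ?U (spectral_schur P (block_weight lam (1 - t)))"
    by (simp add: fun_eq_iff blinfun.add_left blinfun.scaleR_left bounded_linear_Blinfun_apply 0 1
        U_of_convex_combination [OF P])
  ultimately show ?thesis
    unfolding clarke_subdifferential_def by (metis image_eqI)
qed

end

section \<open>Second order conditions\<close>

text \<open>On the line through \<open>x\<close> along \<open>d\<close> the restriction is convex,
  so its derivative is monotone; the derivative of that at 0 is the quadratic form.\<close>

lemma convex_hessian_nonneg:
  fixes \<phi> :: "'a::euclidean_space \<Rightarrow> real"
  assumes conv: "convex_on UNIV \<phi>" and G: "\<And>y. GDERIV \<phi> y :> G y"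
    and H: "(G has_derivative H) (at x)"
  shows "0 \<le> d \<bullet> H d"
proof -
  define \<psi> where "\<psi> s = \<phi> (x + s *\<^sub>R d)" for s :: real
  define \<psi>' where "\<psi>' s = d \<bullet> G (x + s *\<^sub>R d)" for s :: real
  have conv': "convex_on UNIV \<psi>"
  proof (rule convex_onI)
    fix t s s' :: real assume t: "t > 0" "t < 1"
    have "x + ((1 - t) *\<^sub>R s + t *\<^sub>R s') *\<^sub>R d = (1 - t) *\<^sub>R (x + s *\<^sub>R d) + t *\<^sub>R (x + s' *\<^sub>R d)"
      by (simp add: algebra_simps)
    then show "\<psi> ((1 - t) *\<^sub>R s + t *\<^sub>R s') \<le> (1 - t) * \<psi> s + t * \<psi> s'"
      unfolding \<psi>_def using convex_onD [OF conv, of t "x + s *\<^sub>R d" "x + s' *\<^sub>R d"] t by simp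
  qed simp
  have line: "((\<lambda>s. x + s *\<^sub>R d) has_derivative (\<lambda>s. s *\<^sub>R d)) (at s)" for s
    by (auto intro!: derivative_eq_intros)
  have \<psi>: "(\<psi> has_real_derivative \<psi>' s) (at s)" for s
  proof -
    have "(\<psi> has_derivative (\<lambda>u. (u *\<^sub>R d) \<bullet> G (x + s *\<^sub>R d))) (at s)"
      unfolding \<psi>_def using has_derivative_compose [OF line] G [unfolded gderiv_def] by blast
    then show ?thesis
      by (simp add: has_field_derivative_def \<psi>'_def mult.commute [of _ "d \<bullet> _"])
  qed
  have "mono_on UNIV \<psi>'"
  proof (rule mono_onI)
    fix s s' :: real assume "s \<le> s'"
    \<comment> \<open>Tangent inequalities at both endpoints; their sum gives monotonicity.\<close>
    have "\<psi>' s * (s' - s) \<le> \<psi> s' - \<psi> s" "\<psi>' s' * (s - s') \<le> \<psi> s - \<psi> s'"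
      by (auto intro!: convex_on_imp_above_tangent [OF conv'] \<psi>)
    then have "0 \<le> (\<psi>' s' - \<psi>' s) * (s' - s)"
      by (simp add: algebra_simps)
    with \<open>s \<le> s'\<close> show "\<psi>' s \<le> \<psi>' s'"
      by (cases "s = s'") (auto simp: zero_le_mult_iff)
  qed
  moreover have "(\<psi>' has_real_derivative (d \<bullet> H d)) (at 0)"
  proof -
    have "((\<lambda>s. G (x + s *\<^sub>R d)) has_derivative (\<lambda>s. H (s *\<^sub>R d))) (at 0)"
      using has_derivative_compose [OF line [of 0], of G H] H by simp
    then have "(\<psi>' has_derivative (\<lambda>s. d \<bullet> H (s *\<^sub>R d))) (at 0)"
      unfolding \<psi>'_def by (rule has_derivative_inner_right)
    then show ?thesis
      by (simp add: has_field_derivative_def linear_scale [OF has_derivative_linear [OF H]]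
          mult.commute [of _ "d \<bullet> _"])
  qed
  ultimately show ?thesis
    by (rule mono_on_imp_deriv_nonneg) simp
qed

text \<open>
  Compactness of the unit sphere: where \<open>q\<close> fails to be positive, \<open>r\<close> is bounded away from zero.
\<close>

lemma finsler_penalty:
  fixes q r :: "'a::euclidean_space \<Rightarrow> real"
  assumes S: "subspace S" and cont: "continuous_on UNIV q" "continuous_on UNIV r"
    and hom: "\<And>a d. q (a *\<^sub>R d) = a\<^sup>2 * q d" "\<And>a d. r (a *\<^sub>R d) = a\<^sup>2 * r d"
    and r: "\<And>d. 0 \<le> r d"
    and pos: "\<And>d. d \<in> S \<Longrightarrow> d \<noteq> 0 \<Longrightarrow> r d = 0 \<Longrightarrow> 0 < q d"
  obtains c :: real where "0 < c" "\<And>d. d \<in> S \<Longrightarrow> d \<noteq> 0 \<Longrightarrow> 0 < q d + c * r d"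
proof -
  define K where "K = (S \<inter> sphere 0 1) \<inter> {d. q d \<le> 0}"
  have "closed {d. q d \<le> 0}"
    by (intro closed_Collect_le cont continuous_on_const)
  then have K: "compact K"
    unfolding K_def
    by (intro compact_Int_closed closed_Int_compact closed_subspace [OF S] compact_sphere)
  have "\<exists>c>0. \<forall>d\<in>S \<inter> sphere 0 1. 0 < q d + c * r d"
  proof (cases "K = {}")
    case True
    then have "0 < q d + 1 * r d" if "d \<in> S \<inter> sphere 0 1" for d
      using that r [of d] by (force simp: K_def)
    then show ?thesis by (intro exI [of _ 1]) auto
  next
    case False
    obtain d1 where d1: "d1 \<in> K" "\<And>d. d \<in> K \<Longrightarrow> r d1 \<le> r d"
      using continuous_attains_inf [OF K False continuous_on_subset [OF cont(2)]] by auto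
    obtain d2 where d2: "d2 \<in> K" "\<And>d. d \<in> K \<Longrightarrow> q d2 \<le> q d"
      using continuous_attains_inf [OF K False continuous_on_subset [OF cont(1)]] by auto
    \<comment> \<open>A point of \<open>K\<close> has q \<le> 0, so by \<open>pos\<close> the form
      \<open>r\<close> cannot vanish there.\<close>
    have m: "0 < r d1"
      using d1(1) pos [of d1] r [of d1] unfolding K_def by force
    \<comment> \<open>On \<open>K\<close> one has q d \<ge> q d2 and c * r d \<ge> c * r d1 = 1 - q
      d2, so the sum is at least 1. Since q d2 \<le> 0, \<open>c\<close> is positive.\<close>
    define c where "c = (1 - q d2) / r d1"
    have c: "0 < c" using d2(1) m by (simp add: c_def K_def)
    have "0 < q d + c * r d" if d: "d \<in> S \<inter> sphere 0 1" for d
    proof (cases "d \<in> K")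
      case True
      have "1 - q d2 = c * r d1" using m by (simp add: c_def)
      also have "\<dots> \<le> c * r d" using d1(2) [OF True] c by simp
      finally show ?thesis using d2(2) [OF True] by linarith
    next
      case False
      then have "0 < q d" using d by (auto simp: K_def)
      then show ?thesis using c r [of d] by (simp add: add_pos_nonneg)
    qed
    with c show ?thesis by blast
  qed
  then obtain c where c: "0 < c" "\<And>d. d \<in> S \<inter> sphere 0 1 \<Longrightarrow> 0 < q d + c * r d" by blast
  have "0 < q d + c * r d" if d: "d \<in> S" "d \<noteq> 0" for d
  proof -
    define u where "u = inverse (norm d) *\<^sub>R d"
    have u: "u \<in> S \<inter> sphere 0 1" using d S by (simp add: u_def subspace_scale)
    have "d = norm d *\<^sub>R u" using d by (simp add: u_def)
    then have "q d + c * r d = (norm d)\<^sup>2 * (q u + c * r u)"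
      using hom(1) [of "norm d" u] hom(2) [of "norm d" u] by (simp add: algebra_simps)
    then show ?thesis using c(2) [OF u] d by simp
  qed
  with c(1) show ?thesis by (rule that)
qed

section \<open>The inner product split into eigenvalue blocks\<close>

lemma sum_sum_if_mem:
  fixes u :: "'i::finite \<Rightarrow> 'j::finite \<Rightarrow> real"
  shows "(\<Sum>i\<in>UNIV. \<Sum>j\<in>UNIV. if i \<in> A \<and> j \<in> C then u i j else 0) = (\<Sum>i\<in>A. \<Sum>j\<in>C. u i j)"
proof -
  have "(\<Sum>i\<in>UNIV. \<Sum>j\<in>UNIV. if i \<in> A \<and> j \<in> C then u i j else 0)
      = (\<Sum>i\<in>UNIV. if i \<in> A then (\<Sum>j\<in>UNIV. if j \<in> C then u i j else 0) else 0)"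
    by (rule sum.cong) auto
  then show ?thesis by (simp add: sum.If_cases)
qed

lemma sym_mat_inner_eq_sum:
  assumes "orthogonal_matrix P"
  shows "A \<bullet> B = (\<Sum>i\<in>UNIV. \<Sum>j\<in>UNIV.
    mat_of (conj_by (transpose P) A) $ i $ j * mat_of (conj_by (transpose P) B) $ i $ j)"
  unfolding inner_conj_by_orthogonal [OF assms, of A B, symmetric]
  by (simp add: inner_mat_of inner_vec_def)

lemma projection_weight_cases:
  "l i < 0 \<Longrightarrow> l j \<le> 0 \<Longrightarrow> projection_weight l i j = 0"
  "l i \<le> 0 \<Longrightarrow> l j < 0 \<Longrightarrow> projection_weight l i j = 0"
  "l i > 0 \<Longrightarrow> l j \<ge> 0 \<Longrightarrow> projection_weight l i j = 1"
  "l i \<ge> 0 \<Longrightarrow> l j > 0 \<Longrightarrow> projection_weight l i j = 1"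
  "l i > 0 \<Longrightarrow> l j < 0 \<Longrightarrow> projection_weight l i j = l i / (l i - l j)"
  "l i < 0 \<Longrightarrow> l j > 0 \<Longrightarrow> projection_weight l i j = l j / (l j - l i)"
  by (simp_all add: projection_weight_def divide_simps)

text \<open>Entrywise the hypothesis reads B = w (B + G), where G is \<open>Y\<close> in the
  eigenbasis. Weight 0 forces B = 0, weight 1 forces G = 0, and any other weight gives G = (1/w - 1)
  B. The last factor is -lam j / lam i on positive-negative pairs and t / (1 - t) on the zero
  block.\<close>

lemma inner_block_complementary:
  fixes P :: "real^'n^'n::finite" and lam :: "'n \<Rightarrow> real"
  assumes P: "orthogonal_matrix P" and t: "t \<in> {0<..<1}"
    and X: "X = spectral_schur P (block_weight lam (1 - t)) (X + Y)"
  defines "B \<equiv> mat_of (conj_by (transpose P) X)"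
  shows "X \<bullet> Y = - 2 * (\<Sum>i\<in>ix_pos lam. \<Sum>j\<in>ix_neg lam. lam j / lam i * (B $ i $ j)\<^sup>2)
      + t / (1 - t) * (\<Sum>i\<in>ix_zero lam. \<Sum>j\<in>ix_zero lam. (B $ i $ j)\<^sup>2)"
    and "i \<in> ix_zero lam \<Longrightarrow> j \<in> ix_neg lam \<Longrightarrow> B $ i $ j = 0"
    and "i \<in> ix_neg lam \<Longrightarrow> j \<in> ix_neg lam \<Longrightarrow> B $ i $ j = 0"
proof -
  define G where "G = mat_of (conj_by (transpose P) Y)"
  have eq: "B $ i $ j = block_weight lam (1 - t) i j * (B $ i $ j + G $ i $ j)" for i j
    using arg_cong [OF X, of "\<lambda>Z. mat_of (conj_by (transpose P) Z) $ i $ j"]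
    by (simp add: conj_by_spectral_schur [OF P block_weight_commute] linear_conj_by_simps B_def G_def)
  show "i \<in> ix_zero lam \<Longrightarrow> j \<in> ix_neg lam \<Longrightarrow> B $ i $ j = 0"
    and "i \<in> ix_neg lam \<Longrightarrow> j \<in> ix_neg lam \<Longrightarrow> B $ i $ j = 0" for i j
    using eq [of i j] by (simp_all add: block_weight_def projection_weight_cases ix_zero_def ix_neg_def)
  have sym: "B $ j $ i = B $ i $ j" for i j by (simp add: B_def mat_of_sym)
  let ?u = "\<lambda>i j. - (lam j / lam i * (B $ i $ j)\<^sup>2)" and ?v = "\<lambda>i j. t / (1 - t) * (B $ i $ j)\<^sup>2"
  have "B $ i $ j * G $ i $ j
      = (if i \<in> ix_pos lam \<and> j \<in> ix_neg lam then ?u i j else 0)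
      + (if i \<in> ix_neg lam \<and> j \<in> ix_pos lam then ?u j i else 0)
      + (if i \<in> ix_zero lam \<and> j \<in> ix_zero lam then ?v i j else 0)" for i j
  proof -
    have "lam i > 0 \<Longrightarrow> lam j < 0 \<Longrightarrow> G $ i $ j = - (lam j / lam i) * B $ i $ j"
      and "lam i < 0 \<Longrightarrow> lam j > 0 \<Longrightarrow> G $ i $ j = - (lam i / lam j) * B $ i $ j"
      and "lam i = 0 \<Longrightarrow> lam j = 0 \<Longrightarrow> G $ i $ j = t / (1 - t) * B $ i $ j"
      and "lam i < 0 \<Longrightarrow> lam j \<le> 0 \<Longrightarrow> B $ i $ j = 0"
      and "lam i \<le> 0 \<Longrightarrow> lam j < 0 \<Longrightarrow> B $ i $ j = 0"
      and "lam i > 0 \<Longrightarrow> lam j \<ge> 0 \<Longrightarrow> G $ i $ j = 0"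
      and "lam i \<ge> 0 \<Longrightarrow> lam j > 0 \<Longrightarrow> G $ i $ j = 0"
      using eq [of i j] t by (auto simp: block_weight_def projection_weight_cases field_simps)
    then show ?thesis
      by (cases "lam i" "0 :: real" rule: linorder_cases;
          cases "lam j" "0 :: real" rule: linorder_cases)
        (simp_all add: ix_pos_def ix_neg_def ix_zero_def sym [of i j] power2_eq_square)
  qed
  then have "X \<bullet> Y = (\<Sum>i\<in>ix_pos lam. \<Sum>j\<in>ix_neg lam. ?u i j)
      + (\<Sum>i\<in>ix_neg lam. \<Sum>j\<in>ix_pos lam. ?u j i) + (\<Sum>i\<in>ix_zero lam. \<Sum>j\<in>ix_zero lam. ?v i j)"
    by (simp only: sym_mat_inner_eq_sum [OF P] B_def [symmetric] G_def [symmetric] sum.distrib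
        sum_sum_if_mem)
  \<comment> \<open>The two off-diagonal blocks contribute equally, whence the factor 2.\<close>
  also have "(\<Sum>i\<in>ix_neg lam. \<Sum>j\<in>ix_pos lam. ?u j i) = (\<Sum>i\<in>ix_pos lam. \<Sum>j\<in>ix_neg lam. ?u i j)"
    by (rule sum.swap)
  finally show "X \<bullet> Y = - 2 * (\<Sum>i\<in>ix_pos lam. \<Sum>j\<in>ix_neg lam. lam j / lam i * (B $ i $ j)\<^sup>2)
      + t / (1 - t) * (\<Sum>i\<in>ix_zero lam. \<Sum>j\<in>ix_zero lam. (B $ i $ j)\<^sup>2)"
    by (simp only: sum_negf sum_distrib_left [symmetric])
qed

section \<open>Nonsingularity\<close>

context smooth_nlsdp
begin

definition wsoc_form :: "'a \<Rightarrow> real^'m \<Rightarrow> 'n sym_mat \<Rightarrow> real^'n^'n \<Rightarrow> ('n \<Rightarrow> real) \<Rightarrow> 'a \<Rightarrow> real"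
  where "wsoc_form x \<xi> \<Gamma> P lam d = d \<bullet> hess_lagrangian f h g x \<xi> \<Gamma> d
    - 2 * (\<Sum>i\<in>ix_pos lam. \<Sum>j\<in>ix_neg lam. lam j / lam i * (mat_of (calB g x P d) $ i $ j)\<^sup>2)"

definition zero_block_form :: "'a \<Rightarrow> real^'n^'n \<Rightarrow> ('n \<Rightarrow> real) \<Rightarrow> 'a \<Rightarrow> real"
  where "zero_block_form x P lam d =
    (\<Sum>i\<in>ix_zero lam. \<Sum>j\<in>ix_zero lam. (mat_of (calB g x P d) $ i $ j)\<^sup>2)"

text \<open>The constraints of W-SOC except vanishing of the zero block, whose violation
  \<open>zero_block_form\<close> measures. Kernel vectors of the combined operator have their first
  component here.\<close>

definition wsoc_space :: "'a \<Rightarrow> real^'n^'n \<Rightarrow> ('n \<Rightarrow> real) \<Rightarrow> 'a set"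
  where "wsoc_space x P lam = {d. Dh x d = 0 \<and>
    (\<forall>i\<in>ix_zero lam. \<forall>j\<in>ix_neg lam. mat_of (calB g x P d) $ i $ j = 0) \<and>
    (\<forall>i\<in>ix_neg lam. \<forall>j\<in>ix_neg lam. mat_of (calB g x P d) $ i $ j = 0)}"

lemma zero_block_form_nonneg: "0 \<le> zero_block_form x P lam d"
  unfolding zero_block_form_def by (intro sum_nonneg) simp

lemma wsoc_form_pos:
  assumes "W_SOC f h g x \<xi> \<Gamma> P lam" "d \<in> wsoc_space x P lam" "d \<noteq> 0" "zero_block_form x P lam d = 0"
  shows "0 < wsoc_form x \<xi> \<Gamma> P lam d"
proof -
  have "\<forall>i\<in>ix_zero lam. \<forall>j\<in>ix_zero lam. mat_of (calB g x P d) $ i $ j = 0"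
    using assms(4) unfolding zero_block_form_def
    by (simp add: sum_nonneg_eq_0_iff sum_nonneg)
  then show ?thesis
    using assms(1-3) unfolding W_SOC_def wsoc_form_def wsoc_space_def frechet_h by blast
qed

text \<open>An injective linear endomorphism in finite dimensions is bijective, so a trivial kernel
  suffices. The hypothesis \<open>pos\<close> isolates the only point where the general and the
  convex case differ.\<close>

lemma nonsingular_U_of:
  assumes P: "orthogonal_matrix P" and t: "t \<in> {0<..<1}" and cq: "W_SRCQ h g x P lam"
    and pos: "\<And>d. d \<in> wsoc_space x P lam \<Longrightarrow> d \<noteq> 0
      \<Longrightarrow> 0 < wsoc_form x \<xi> \<Gamma> P lam d + t / (1 - t) * zero_block_form x P lam d"
  shows "nonsingular (U_of (spectral_schur P (block_weight lam (1 - t))) f h g x \<xi> \<Gamma>)"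
    (is "nonsingular ?U")
proof -
  let ?V = "spectral_schur P (block_weight lam (1 - t))" and ?c = "conj_by (transpose P)"
  have linV: "linear ?V"
    by (intro linear_spectral_schur [OF P] block_weight_commute)
  have lin: "linear ?U"
    by (rule linear_U_of [OF linV])
  have lin': "linear (blinfun_apply (Dh x))" "linear (blinfun_apply (Dg x))"
    by (simp_all add: blinfun.bounded_linear_right bounded_linear.linear)
  have "z = 0" if Uz: "?U z = 0" for z
  proof -
    obtain d \<eta> \<Delta> where z: "z = (d, \<eta>, \<Delta>)" by (cases z)
    have eq1: "hess_lagrangian f h g x \<xi> \<Gamma> d + adjoint (Dh x) \<eta> + adjoint (Dg x) \<Delta> = 0"
      and eq2: "Dh x d = 0" and eq3: "Dg x d = ?V (Dg x d + \<Delta>)"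
      using Uz by (simp_all add: z U_of_def zero_prod_def frechet_h frechet_g)
    have calB: "calB g x P d = ?c (Dg x d)" by (simp add: calB_def frechet_g)
    note compl = inner_block_complementary [OF P t eq3, folded calB]
    \<comment> \<open>Pairing with \<open>d\<close> removes the \<eta> term by \<open>eq2\<close>;
      the \<Delta> term becomes the inner product evaluated by \<open>compl(1)\<close>.\<close>
    have "0 = d \<bullet> (hess_lagrangian f h g x \<xi> \<Gamma> d + adjoint (Dh x) \<eta> + adjoint (Dg x) \<Delta>)"
      by (simp add: eq1)
    also have "\<dots> = d \<bullet> hess_lagrangian f h g x \<xi> \<Gamma> d + Dg x d \<bullet> \<Delta>"
      by (simp add: inner_add_right adjoint_works lin' eq2)
    also have "\<dots> = wsoc_form x \<xi> \<Gamma> P lam d + t / (1 - t) * zero_block_form x P lam d"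
      unfolding compl(1) wsoc_form_def zero_block_form_def by simp
    finally have "d = 0"
      using pos [of d] compl(2,3) eq2 unfolding wsoc_space_def by force
    then have V: "?V \<Delta> = 0" and orth: "adjoint (Dh x) \<eta> + adjoint (Dg x) \<Delta> = 0"
      using eq1 eq3 by (simp_all add: hess_lagrangian_eq)
    have G: "block_weight lam (1 - t) i j * mat_of (?c \<Delta>) $ i $ j = 0" for i j
      using conj_by_spectral_schur [of P "block_weight lam (1 - t)" \<Delta> i j, OF P block_weight_commute]
      by (simp add: V linear_0 [OF linear_conj_by])
    \<comment> \<open>W-SRCQ is applied to the multiplier increment itself: decomposed in this way,
      it turns out orthogonal to both of its summands.\<close>
    have "(\<eta>, \<Delta>) \<in> {u + v | u v.
       u \<in> range (\<lambda>d. (frechet_derivative h (at x) d, frechet_derivative g (at x) d)) \<and>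
       v \<in> {0} \<times> {conj_by P B | B.
              (\<forall>i\<in>ix_zero lam. \<forall>j\<in>ix_neg lam. mat_of B $ i $ j = 0) \<and>
              (\<forall>i\<in>ix_neg lam. \<forall>j\<in>ix_neg lam. mat_of B $ i $ j = 0)}}"
      using cq unfolding W_SRCQ_def by simp
    then obtain e C where eC: "\<eta> = Dh x e" "\<Delta> = Dg x e + conj_by P C"
      and C: "\<forall>i\<in>ix_zero lam. \<forall>j\<in>ix_neg lam. mat_of C $ i $ j = 0"
        "\<forall>i\<in>ix_neg lam. \<forall>j\<in>ix_neg lam. mat_of C $ i $ j = 0"
      by (auto simp: frechet_h frechet_g)
    \<comment> \<open>Since V \<Delta> = 0, \<Delta> lives only where the weight vanishes: the
      negative-negative and the mixed zero-negative blocks. There \<open>C\<close> vanishes.\<close>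
    have "mat_of (?c \<Delta>) $ i $ j * mat_of C $ i $ j = 0" for i j
    proof (cases "lam i \<le> 0 \<and> lam j \<le> 0 \<and> (lam i < 0 \<or> lam j < 0)")
      case True
      then have "mat_of C $ i $ j = 0"
        using C mat_of_sym [of C i j] by (auto simp: ix_zero_def ix_neg_def less_le)
      then show ?thesis by simp
    next
      case False
      have "block_weight lam (1 - t) i j \<noteq> 0"
        using False t
        by (cases "lam i" "0 :: real" rule: linorder_cases;
            cases "lam j" "0 :: real" rule: linorder_cases)
          (auto simp: block_weight_def projection_weight_cases)
      then show ?thesis using G [of i j] by simp
    qed
    then have "\<Delta> \<bullet> conj_by P C = 0"
      by (simp only: sym_mat_inner_eq_sum [OF P] conj_by_orthogonal_cancel [OF P] sum.neutral_const)
    moreover have "\<eta> \<bullet> Dh x e + \<Delta> \<bullet> Dg x e = e \<bullet> (adjoint (Dh x) \<eta> + adjoint (Dg x) \<Delta>)"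
      by (simp add: inner_add_right adjoint_works lin' inner_commute)
    ultimately have "\<eta> \<bullet> \<eta> + \<Delta> \<bullet> \<Delta> = 0"
      using orth by (simp add: eC(1)[symmetric]) (metis eC add.assoc add_0_right inner_add_right)
    then have "\<eta> = 0" "\<Delta> = 0"
      by (simp_all add: add_nonneg_eq_0_iff)
    with \<open>d = 0\<close> show "z = 0" by (simp add: z zero_prod_def)
  qed
  then have "inj ?U"
    using linear_injective_0 [OF lin] by blast
  then show ?thesis
    unfolding nonsingular_def bij_def using lin linear_injective_imp_surjective [OF lin] by blast
qed

lemma ex_nonsingular_U_of:
  assumes P: "orthogonal_matrix P" and cq: "W_SRCQ h g x P lam" and soc: "W_SOC f h g x \<xi> \<Gamma> P lam"
  obtains t where "t \<in> {0<..<1}"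
    "nonsingular (U_of (spectral_schur P (block_weight lam (1 - t))) f h g x \<xi> \<Gamma>)"
proof -
  let ?B = "\<lambda>i j d. mat_of (calB g x P d) $ i $ j"
  have linB: "linear (?B i j)" for i j
    by (rule linearI) (simp_all add: calB_def frechet_g linear_conj_by_simps
        blinfun.add_right blinfun.scaleR_right)
  have linH: "linear (hess_lagrangian f h g x \<xi> \<Gamma>)"
    using has_derivative_grad_lagrangian has_derivative_linear by blast
  have contB: "continuous_on UNIV (?B i j)" for i j
    using linB [of i j] by (simp add: linear_continuous_on linear_conv_bounded_linear)
  have contH: "continuous_on UNIV (hess_lagrangian f h g x \<xi> \<Gamma>)"
    using linH by (simp add: linear_continuous_on linear_conv_bounded_linear)
  have S: "subspace (wsoc_space x P lam)"
    unfolding subspace_def wsoc_space_def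
    by (simp add: blinfun.add_right blinfun.scaleR_right blinfun.zero_right
        linear_add [OF linB] linear_scale [OF linB] linear_0 [OF linB])
  have cont: "continuous_on UNIV (wsoc_form x \<xi> \<Gamma> P lam)"
    "continuous_on UNIV (zero_block_form x P lam)"
    unfolding wsoc_form_def zero_block_form_def
    by (intro continuous_intros contB contH)+
  have hom: "wsoc_form x \<xi> \<Gamma> P lam (a *\<^sub>R d) = a\<^sup>2 * wsoc_form x \<xi> \<Gamma> P lam d"
    "zero_block_form x P lam (a *\<^sub>R d) = a\<^sup>2 * zero_block_form x P lam d" for a d
    unfolding wsoc_form_def zero_block_form_def
    by (simp_all add: linear_scale [OF linB] linear_scale [OF linH] sum_distrib_left
        power2_eq_square algebra_simps)
  obtain c where c: "0 < c"
    "\<And>d. d \<in> wsoc_space x P lam \<Longrightarrow> d \<noteq> 0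
      \<Longrightarrow> 0 < wsoc_form x \<xi> \<Gamma> P lam d + c * zero_block_form x P lam d"
  proof (rule finsler_penalty [OF S cont hom zero_block_form_nonneg])
    fix d assume "d \<in> wsoc_space x P lam" "d \<noteq> 0" "zero_block_form x P lam d = 0"
    then show "0 < wsoc_form x \<xi> \<Gamma> P lam d" by (rule wsoc_form_pos [OF soc])
  qed blast
  \<comment> \<open>Chosen to solve t / (1 - t) = c, so the penalty constant becomes the coefficient
    of the zero block.\<close>
  define t where "t = c / (1 + c)"
  have t: "t \<in> {0<..<1}" "t / (1 - t) = c"
    using c(1) by (simp_all add: t_def field_simps)
  show thesis
    by (rule that [OF t(1) nonsingular_U_of [OF P t(1) cq]]) (simp add: t(2) c(2))
qed

text \<open>A normal vector \<Gamma> pairs nonpositively with the cone, while the convexity defect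
  of \<open>g\<close> lies in the cone. Hence \<Gamma> \<bullet> g is convex, and so is the whole
  Lagrangian.\<close>

lemma hess_lagrangian_nonneg:
  assumes conv: "convex_nlsdp f h g" and \<Gamma>: "\<Gamma> \<in> normal_cone psd_cone (g x)"
  shows "0 \<le> d \<bullet> hess_lagrangian f h g x \<xi> \<Gamma> d"
proof (rule convex_hessian_nonneg [OF _ _ has_derivative_grad_lagrangian])
  show "GDERIV (\<lambda>y. lagrangian f h g y \<xi> \<Gamma>) y :> grad_lagrangian f h g y \<xi> \<Gamma>" for y
    unfolding gderiv_def inner_grad_lagrangian by (rule has_derivative_lagrangian)
  \<comment> \<open>The normal cone inequality is tested at \<open>g x + Z\<close>.\<close>
  have \<Gamma>_nonpos: "\<Gamma> \<bullet> Z \<le> 0" if "Z \<in> psd_cone" for Z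
    using \<Gamma> psd_cone_add [of "g x" Z] that unfolding normal_cone_def by force
  obtain T c where T: "linear T" and h: "\<And>y. h y = T y + c"
    using conv unfolding convex_nlsdp_def by blast
  show "convex_on UNIV (\<lambda>y. lagrangian f h g y \<xi> \<Gamma>)"
  proof (rule convex_onI)
    fix t :: real and y z :: 'a assume t: "t > 0" "t < 1"
    let ?w = "(1 - t) *\<^sub>R y + t *\<^sub>R z"
    have "f ?w \<le> (1 - t) * f y + t * f z"
      using conv t convex_onD [of UNIV f t y z] unfolding convex_nlsdp_def by simp
    moreover have "\<xi> \<bullet> h ?w = (1 - t) * (\<xi> \<bullet> h y) + t * (\<xi> \<bullet> h z)"
      by (simp add: h linear_add [OF T] linear_scale [OF T] inner_add_right) (simp add: algebra_simps)
    moreover have "g ?w - (1 - t) *\<^sub>R g y - t *\<^sub>R g z \<in> psd_cone"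
    proof -
      have "psd_convex g" using conv by (simp add: convex_nlsdp_def)
      moreover have "1 - t \<in> {0<..<1}" using t by simp
      ultimately have "g ((1 - t) *\<^sub>R y + (1 - (1 - t)) *\<^sub>R z) - (1 - t) *\<^sub>R g y
          - (1 - (1 - t)) *\<^sub>R g z \<in> psd_cone"
        unfolding psd_convex_def by blast
      then show ?thesis by simp
    qed
    from \<Gamma>_nonpos [OF this] have "\<Gamma> \<bullet> g ?w \<le> (1 - t) * (\<Gamma> \<bullet> g y) + t * (\<Gamma> \<bullet> g z)"
      by (simp add: inner_diff_right)
    ultimately show "lagrangian f h g ?w \<xi> \<Gamma> \<le> (1 - t) * lagrangian f h g y \<xi> \<Gamma> + t * lagrangian f h g z \<xi> \<Gamma>"
      unfolding lagrangian_def by (simp add: algebra_simps)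
  qed simp
qed

text \<open>The ratios lam j / lam i are negative, so the curvature term only increases the
  nonnegative Hessian form. Strictness comes from W-SOC when the zero block vanishes, and from the
  zero-block term otherwise.\<close>

lemma nonsingular_U_of_convex:
  assumes P: "orthogonal_matrix P" and t: "t \<in> {0<..<1}"
    and cq: "W_SRCQ h g x P lam" and soc: "W_SOC f h g x \<xi> \<Gamma> P lam"
    and conv: "convex_nlsdp f h g" and \<Gamma>: "\<Gamma> \<in> normal_cone psd_cone (g x)"
  shows "nonsingular (U_of (spectral_schur P (block_weight lam (1 - t))) f h g x \<xi> \<Gamma>)"
proof (rule nonsingular_U_of [OF P t cq])
  fix d assume d: "d \<in> wsoc_space x P lam" "d \<noteq> 0"
  have "(\<Sum>i\<in>ix_pos lam. \<Sum>j\<in>ix_neg lam. lam j / lam i * (mat_of (calB g x P d) $ i $ j)\<^sup>2) \<le> 0"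
    by (intro sum_nonpos mult_nonpos_nonneg divide_nonpos_pos) (auto simp: ix_pos_def ix_neg_def)
  then have q: "0 \<le> wsoc_form x \<xi> \<Gamma> P lam d"
    using hess_lagrangian_nonneg [OF conv \<Gamma>, of d \<xi>] unfolding wsoc_form_def by linarith
  show "0 < wsoc_form x \<xi> \<Gamma> P lam d + t / (1 - t) * zero_block_form x P lam d"
  proof (cases "zero_block_form x P lam d = 0")
    case True
    then show ?thesis using wsoc_form_pos [OF soc d] by simp
  next
    case False
    then have "0 < zero_block_form x P lam d"
      using zero_block_form_nonneg [of x P lam d] by linarith
    then show ?thesis using q t by (simp add: add_nonneg_pos)
  qed
qed

end

theorem proposition4:
  fixes f :: "'a::euclidean_space \<Rightarrow> real"
    and h :: "'a \<Rightarrow> real^'m"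
    and g :: "'a \<Rightarrow> 'n::{finite,linorder} sym_mat"
    and xbar :: 'a and \<xi>bar :: "real^'m" and \<Gamma>bar :: "'n sym_mat"
    and P :: "real^'n::{finite,linorder}^'n::{finite,linorder}" and lam :: "'n \<Rightarrow> real"
  assumes "twice_continuously_differentiable f"
    and "twice_continuously_differentiable h"
    and "twice_continuously_differentiable g"
    and "stationary_point f h g xbar"
    and "(\<xi>bar, \<Gamma>bar) \<in> multipliers f h g xbar"
    and "spectral_decomposition (g xbar + \<Gamma>bar) P lam"
    and "W_SOC f h g xbar \<xi>bar \<Gamma>bar P lam"
    and "W_SRCQ h g xbar P lam"
  shows "let U\<^sub>0 = U_of (V_zero P lam) f h g xbar \<xi>bar \<Gamma>bar;
             U\<^sub>I = U_of (V_id P lam) f h g xbar \<xi>bar \<Gamma>bar;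
             U = (\<lambda>t z. t *\<^sub>R U\<^sub>0 z + (1 - t) *\<^sub>R U\<^sub>I z);
             dF = clarke_subdifferential (kkt_residual f h g) (xbar, \<xi>bar, \<Gamma>bar)
         in (\<exists>t\<in>{0<..<1}. U t \<in> blinfun_apply ` dF \<and> nonsingular (U t)) \<and>
            (convex_nlsdp f h g \<longrightarrow>
               (\<forall>t\<in>{0<..<1}. U t \<in> blinfun_apply ` dF \<and> nonsingular (U t)))"
proof -
  obtain Df D2f where Df: "\<And>x. (f has_derivative blinfun_apply (Df x)) (at x)"
    "\<And>x. (Df has_derivative blinfun_apply (D2f x)) (at x)"
    using assms(1) unfolding twice_continuously_differentiable_def by blast
  obtain Dh D2h where Dh: "\<And>x. (h has_derivative blinfun_apply (Dh x)) (at x)"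
    "\<And>x. (Dh has_derivative blinfun_apply (D2h x)) (at x)"
    using assms(2) unfolding twice_continuously_differentiable_def by blast
  obtain Dg D2g where Dg: "\<And>x. (g has_derivative blinfun_apply (Dg x)) (at x)"
    "\<And>x. (Dg has_derivative blinfun_apply (D2g x)) (at x)"
    using assms(3) unfolding twice_continuously_differentiable_def by blast
  interpret smooth_nlsdp f h g Df D2f Dh D2h Dg D2g
    by unfold_locales (fact Df Dh Dg)+
  have P: "orthogonal_matrix P" and A: "g xbar + \<Gamma>bar = conj_by P (diag_sym lam)"
    using assms(6) by (simp_all add: spectral_decomposition_def)
  have \<Gamma>: "\<Gamma>bar \<in> normal_cone psd_cone (g xbar)"
    using assms(5) by (simp add: multipliers_def kkt_point_def)
  let ?U = "\<lambda>t. U_of (spectral_schur P (block_weight lam (1 - t))) f h g xbar \<xi>bar \<Gamma>bar"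
  let ?dF = "clarke_subdifferential (kkt_residual f h g) (xbar, \<xi>bar, \<Gamma>bar)"
  have "\<exists>t\<in>{0<..<1}. ?U t \<in> blinfun_apply ` ?dF \<and> nonsingular (?U t)"
    by (rule ex_nonsingular_U_of [OF P assms(8,7)]) (blast intro: clarke_U_of [OF P A])
  moreover have "\<forall>t\<in>{0<..<1}. ?U t \<in> blinfun_apply ` ?dF \<and> nonsingular (?U t)"
    if "convex_nlsdp f h g"
    using clarke_U_of [OF P A] nonsingular_U_of_convex [OF P _ assms(8,7) that \<Gamma>] by blast
  ultimately show ?thesis
    unfolding Let_def U_of_convex_combination [OF P] by (intro conjI impI)
qed

end
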